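(* Let $N\ge 2$, let $\Omega\subset\mathbb R^N$ be a domain, and let $p,q\in\mathbb R$ satisfy $$p+q<\frac{N+3}{N-1}.$$ Let $u$ be a positive solution of $-\Delta u=u^p|\nabla u|^q$ in $\Omega$. Then there exists a constant $C=C(N,p,q)>0$ (depending only on $N,p,q$) such that $$\left(\frac{|\nabla u|}{u}\right)(x)\le C\,\mathrm{dist}^{-1}(x,\partial\Omega),\qquad x\in\Omega.$$
   Context: A (weak) solution of $-\Delta u=u^p|\nabla u|^q$ in $\Omega$ is a function $u\in C^1(\Omega)$ such that $u^p|\nabla u|^q\in L^1_{loc}(\Omega)$ and $\int_\Omega\langle\nabla u,\nabla\psi\rangle=\int_\Omega u^p|\nabla u|^q\psi$ for all $\psi\in C_0^\infty(\Omega)$. The exponents $p,q$ are real and may be negative; for $q<0$ the term $u^p|\nabla u|^q$ is singular (equal to $+\infty$) where $\nabla u=0$; for $q=0$ the equation is $-\Delta u=u^p$. Here $\mathrm{dist}^{-1}(x,\partial\Omega)=1/\mathrm{dist}(x,\partial\Omega)$, read as $0$ if $\Omega=\mathbb R^N$. *)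

theory Defs
  imports "HOL-Analysis.Analysis"
begin

definition grad :: "(real^'n \<Rightarrow> real) \<Rightarrow> real^'n \<Rightarrow> real^'n" where
  "grad f x = (\<chi> i. frechet_derivative f (at x) (axis i 1))"

(* Intended for open S. The class C^k(S), by recursion on the first-order partial derivatives. *)
primrec Ck_on :: "nat \<Rightarrow> (real^'n) set \<Rightarrow> (real^'n \<Rightarrow> real) \<Rightarrow> bool" where
  "Ck_on 0 S f \<longleftrightarrow> continuous_on S f"
| "Ck_on (Suc k) S f \<longleftrightarrow>
     (\<forall>x\<in>S. f differentiable (at x)) \<and> (\<forall>i. Ck_on k S (\<lambda>x. grad f x $ i))"

(* Elements of C_0^infinity(Omega), extended by 0 to the whole space. *)
definition test_function :: "(real^'n) set \<Rightarrow> (real^'n \<Rightarrow> real) \<Rightarrow> bool" where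
  "test_function \<Omega> \<psi> \<longleftrightarrow>
     (\<forall>k. Ck_on k UNIV \<psi>) \<and> compact (closure {x. \<psi> x \<noteq> 0}) \<and> closure {x. \<psi> x \<noteq> 0} \<subseteq> \<Omega>"

(* The power t^a for t >= 0 with values in [0, infinity]. The library's powr is not
   usable at t = 0, since it has 0 powr a = 0 for every a; here 0^a is infinity for
   a < 0 and 0^0 = 1. *)
definition epowr :: "real \<Rightarrow> real \<Rightarrow> ennreal" where
  "epowr t a =
     (if t = 0 then (if a < 0 then \<infinity> else if a = 0 then 1 else 0) else ennreal (t powr a))"

definition source :: "real \<Rightarrow> real \<Rightarrow> (real^'n \<Rightarrow> real) \<Rightarrow> real^'n \<Rightarrow> ennreal" where
  "source p q u x = epowr (u x) p * epowr (norm (grad u x)) q"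

definition L1_loc :: "(real^'n) set \<Rightarrow> (real^'n \<Rightarrow> ennreal) \<Rightarrow> bool" where
  "L1_loc \<Omega> f \<longleftrightarrow>
     (\<forall>K. compact K \<and> K \<subseteq> \<Omega> \<longrightarrow>
        (\<lambda>x. f x * indicator K x) \<in> borel_measurable lborel \<and>
        (\<integral>\<^sup>+x. f x * indicator K x \<partial>lborel) < \<infinity>)"

(* Positive weak solutions of - Laplace u = u^p |grad u|^q in Omega; only the values of u
   on Omega matter. The source term is locally integrable, hence finite almost everywhere
   in Omega, so passing to enn2real changes it only on a null set. *)
definition positive_weak_solution ::
    "real \<Rightarrow> real \<Rightarrow> (real^'n) set \<Rightarrow> (real^'n \<Rightarrow> real) \<Rightarrow> bool" where
  "positive_weak_solution p q \<Omega> u \<longleftrightarrow>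
     Ck_on 1 \<Omega> u \<and> (\<forall>x\<in>\<Omega>. u x > 0) \<and> L1_loc \<Omega> (source p q u) \<and>
     (\<forall>\<psi>. test_function \<Omega> \<psi> \<longrightarrow>
        (LINT x:\<Omega>|lborel. grad u x \<bullet> grad \<psi> x) =
        (LINT x:\<Omega>|lborel. enn2real (source p q u x) * \<psi> x))"

definition inv_dist_boundary :: "(real^'n) set \<Rightarrow> real^'n \<Rightarrow> real" where
  "inv_dist_boundary \<Omega> x = (if \<Omega> = UNIV then 0 else 1 / infdist x (frontier \<Omega>))"

end

theory Submission
  imports Defs
begin

text \<open>
  Bernstein's method for \<open>log u\<close>. With \<open>V = \<nabla>u/u\<close>, \<open>H = |V|\<^sup>2\<close> and \<open>F = u\<^sup>p\<^sup>-\<^sup>1 |\<nabla>u|\<^sup>q\<close> one has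
  \<open>div V = - F - H\<close>. In Bochner's formula for \<open>H\<close> the Hessian term is at least
  \<open>(F + H)\<^sup>2/(N - 1)\<close> up to terms in \<open>\<nabla>H\<close>, and \<open>(F + H)\<^sup>2/(N - 1) - (p + q - 1) F H\<close> is
  positive definite for \<open>F, H \<ge> 0\<close> exactly when \<open>p + q - 1 < 4/(N - 1)\<close>. Hence, for a cutoff
  \<open>E\<close> vanishing to second order on the boundary of a ball of radius \<open>R\<close>, the function
  \<open>G = E H\<close> cannot have an interior maximum larger than a multiple of \<open>R\<^sup>2\<close>.

  As \<open>u\<close> is only \<open>C\<^sup>1\<close>, the argument is run on a mollification of \<open>u\<close>, which solves the
  equation up to an error \<open>r\<close> that is uniformly small, but without control of \<open>\<nabla>r\<close>, where
  \<open>G\<close> is bounded below. The maximum principle is therefore replaced by integrating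
  \<open>div ((G - k)\<^sub>+\<^sup>m (\<nabla>G/2 + E r V))\<close>, in which \<open>\<nabla>r\<close> cancels against Bochner's formula.
  The drift term linear in \<open>\<nabla>G\<close> is absorbed by choosing \<open>m\<close> large, and letting \<open>r\<close> tend
  to \<open>0\<close> gives \<open>G \<le> k\<close>.
\<close>

section \<open>Integration by parts without boundary terms\<close>

text \<open>At an interior maximum of \<open>G\<close> the derivative of \<open>H\<close> along
  \<open>V\<close> is prescribed by the cutoff, which leaves a quadratic form in \<open>F\<close>,
  \<open>H\<close> and a cutoff term \<open>s\<close>. As E = \<eta>^2, that term costs at most a
  multiple of H R^2, and \<open>G\<close> equals R^4 H at the centre: so G \<le> k with k of order
  R^2 is the bound |grad u|/u \<le> const/R there. The obstacle is regularity. Bochner's formula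
  takes three derivatives of \<open>u\<close>, and for q < 0 the source is singular at critical
  points of \<open>u\<close>. Both difficulties are met on {G \<ge> k} with k > 0: this set stays
  away from the sphere and from the critical points, so there the source is continuous and a
  mollification perturbs it by a uniformly small amount. The order of choices matters: bounds for
  \<open>H\<close> and \<open>F\<close> with room for a perturbation; from them the coefficient
  \<open>B\<close> of the drift; then the exponent, large compared with \<open>B\<close>; then the
  admissible size \<delta> of \<open>r\<close>; last the mollification radius. The exponent
  therefore stays fixed while \<open>r\<close> becomes small.\<close>

lemma lborel_integral_translate:
  fixes f :: "'a::euclidean_space \<Rightarrow> 'b::{banach, second_countable_topology}"
  assumes "integrable lborel f"
  shows "integrable lborel (\<lambda>x. f (c + x))" "(LINT x|lborel. f (c + x)) = (LINT x|lborel. f x)"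
proof -
  have 0: "integrable (distr lborel borel ((+) c)) f" using assms by (simp only: lborel_distr_plus)
  then show "integrable lborel (\<lambda>x. f (c + x))"
    by (subst (asm) integrable_distr_eq) (use assms in auto)
  have "(LINT x|lborel. f x) = (LINT x|distr lborel borel ((+) c). f x)"
    by (simp only: lborel_distr_plus)
  also have "\<dots> = (LINT x|lborel. f (c + x))" by (subst integral_distr) (use assms in auto)
  finally show "(LINT x|lborel. f (c + x)) = (LINT x|lborel. f x)" by simp
qed

text \<open>Extension by zero makes \<open>g\<close> differentiable on the whole space, whatever the
  boundary of \<open>M\<close> looks like. By translation invariance every difference quotient has
  integral zero, and dominated convergence passes this on to the partial derivatives.\<close>

lemma set_integral_gradient_eq_0:
  fixes g :: "'a::euclidean_space \<Rightarrow> real"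
  assumes "open S" "compact M" "M \<subseteq> S"
    and der: "\<And>x. x \<in> S \<Longrightarrow> GDERIV g x :> Dg x"
    and cont: "continuous_on S Dg"
    and zero: "\<And>x. x \<in> S \<Longrightarrow> x \<notin> M \<Longrightarrow> g x = 0"
  shows "(LINT x:M|lborel. Dg x) = 0"
proof -
  define ge where "ge x = (if x \<in> M then g x else 0)" for x
  define De where "De x = indicator M x *\<^sub>R Dg x" for x
  have geS: "ge x = g x" if "x \<in> S" for x using zero that by (auto simp: ge_def)
  have der_ge: "GDERIV ge x :> De x" for x
  proof (cases "x \<in> M")
    case True
    then have "x \<in> S" using assms by auto
    have "(ge has_derivative (\<lambda>h. h \<bullet> Dg x)) (at x)"
      using der[OF \<open>x \<in> S\<close>] unfolding gderiv_def
      by (rule has_derivative_transform_within_open[OF _ \<open>open S\<close> \<open>x \<in> S\<close>]) (simp add: geS)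
    then show ?thesis using True by (simp add: De_def gderiv_def)
  next
    case False
    have "(ge has_derivative (\<lambda>h. 0)) (at x)"
      by (rule has_derivative_transform_within_open[of "\<lambda>_. 0" _ _ _ "-M"])
        (use False \<open>compact M\<close> in \<open>auto simp: ge_def compact_imp_closed open_Compl\<close>)
    then show ?thesis using False by (simp add: De_def gderiv_def)
  qed
  have contM: "continuous_on M Dg" using cont assms(3) continuous_on_subset by blast
  then have "bounded (Dg ` M)" using \<open>compact M\<close> compact_continuous_image compact_imp_bounded by blast
  then obtain L where L: "L > 0" "\<And>x. x \<in> M \<Longrightarrow> norm (Dg x) \<le> L"
    unfolding bounded_pos by auto
  have DeL: "norm (De x) \<le> L" for x using L by (auto simp: De_def indicator_def intro: less_imp_le)
  have lip: "\<bar>ge x - ge y\<bar> \<le> L * norm (x - y)" for x y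
  proof -
    have "norm (ge x - ge y) \<le> L * norm (x - y)"
    proof (rule differentiable_bound[of UNIV ge "\<lambda>x h. h \<bullet> De x"])
      show "onorm (\<lambda>h. h \<bullet> De x) \<le> L" for x
        by (rule onorm_le)
          (metis Cauchy_Schwarz_ineq2 DeL mult.commute mult_left_mono norm_ge_zero order_trans real_norm_def)
    qed (use der_ge in \<open>auto simp: gderiv_def\<close>)
    then show ?thesis by simp
  qed
  have geC: "continuous_on UNIV ge"
    using der_ge unfolding gderiv_def
    by (meson has_derivative_continuous continuous_at_imp_continuous_on)
  have gei: "integrable lborel ge"
  proof -
    have "integrable lborel (\<lambda>x. indicator M x *\<^sub>R ge x)"
      using assms geC by (intro borel_integrable_compact) (auto intro: continuous_on_subset)
    moreover have "(\<lambda>x. indicator M x *\<^sub>R ge x) = ge" by (auto simp: ge_def fun_eq_iff)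
    ultimately show ?thesis by simp
  qed
  note transl = lborel_integral_translate[OF gei]
  have De_int: "integrable lborel De"
    unfolding De_def using borel_integrable_compact[OF \<open>compact M\<close> contM] .
  obtain R where R: "R > 0" "M \<subseteq> cball 0 R"
    using compact_imp_bounded[OF \<open>compact M\<close>] bounded_subset_ballD
    by (metis ball_subset_cball order_trans)
  have "integral\<^sup>L lborel De \<bullet> b = 0" if b: "b \<in> Basis" for b
  proof -
    \<comment> \<open>Steps of length at most 1 keep all difference quotients supported in the ball
      of radius R + 1, where the Lipschitz constant \<open>L\<close> dominates them.\<close>
    define t where "t n = 1 / real (Suc n)" for n
    have t: "0 < t n" "t n \<le> 1" for n by (auto simp: t_def divide_simps)
    define s where "s n x = (ge (t n *\<^sub>R b + x) - ge x) / t n" for n x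
    have nb: "norm b = 1" using b by simp
    have "(\<lambda>n. integral\<^sup>L lborel (s n)) \<longlonglongrightarrow> integral\<^sup>L lborel (\<lambda>x. b \<bullet> De x)"
    proof (rule integral_dominated_convergence[where w = "\<lambda>x. indicator (cball 0 (R+1)) x *\<^sub>R L"])
      show "(\<lambda>x. b \<bullet> De x) \<in> borel_measurable lborel" using De_int by simp
      show "s n \<in> borel_measurable lborel" for n
        unfolding s_def using gei transl(1)[of "t n *\<^sub>R b"] by (intro borel_measurable_divide borel_measurable_diff) auto
      show "integrable lborel (\<lambda>x. indicator (cball 0 (R+1)) x *\<^sub>R L)"
        by (rule borel_integrable_compact) auto
      show "AE x in lborel. (\<lambda>n. s n x) \<longlonglongrightarrow> b \<bullet> De x"
      proof (rule AE_I2)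
        fix x
        have "((\<lambda>h. ge (x + h *\<^sub>R b)) has_derivative (\<lambda>h. (h *\<^sub>R b) \<bullet> De x)) (at 0)"
          using der_ge[of x] unfolding gderiv_def
          by (intro has_derivative_compose[of "\<lambda>h. x + h *\<^sub>R b" _ _ _ ge "\<lambda>h. h \<bullet> De x", simplified])
            (auto intro!: derivative_eq_intros)
        then have "((\<lambda>h. ge (x + h *\<^sub>R b)) has_field_derivative (b \<bullet> De x)) (at 0)"
          by (simp add: has_field_derivative_def mult.commute[of _ "b \<bullet> De x"])
        then have *: "(\<lambda>h. (ge (x + h *\<^sub>R b) - ge x) / h) \<midarrow>0\<rightarrow> b \<bullet> De x"
          by (simp add: DERIV_def)
        have "t \<longlonglongrightarrow> 0" unfolding t_def using LIMSEQ_inverse_real_of_nat by (simp add: inverse_eq_divide)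
        then have "filterlim t (at 0) sequentially"
          by (rule filterlim_atI) (use t(1) in \<open>auto intro!: always_eventually simp: less_imp_neq[symmetric]\<close>)
        from filterlim_compose[OF * this] show "(\<lambda>n. s n x) \<longlonglongrightarrow> b \<bullet> De x"
          by (simp add: s_def add.commute)
      qed
      show "AE x in lborel. norm (s n x) \<le> indicator (cball 0 (R+1)) x *\<^sub>R L" for n
      proof (rule AE_I2)
        fix x
        show "norm (s n x) \<le> indicator (cball 0 (R+1)) x *\<^sub>R L"
        proof (cases "x \<in> cball 0 (R+1)")
          case True
          have "\<bar>ge (t n *\<^sub>R b + x) - ge x\<bar> \<le> L * t n"
            using lip[of "t n *\<^sub>R b + x" x] t[of n] nb by simp
          then show ?thesis using True t[of n] by (simp add: s_def divide_simps)
        next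
          case False
          then have n: "norm x > R + 1" by simp
          have "norm x \<le> norm (t n *\<^sub>R b + x) + norm (t n *\<^sub>R b)"
            using norm_diff_ineq[of x "t n *\<^sub>R b"] by (simp add: add.commute)
          then have "norm (t n *\<^sub>R b + x) > R" using n nb t[of n] by simp
          then have "ge (t n *\<^sub>R b + x) = 0" "ge x = 0"
            using R n by (force simp: ge_def)+
          then show ?thesis using L by (simp add: s_def)
        qed
      qed
    qed
    moreover have "integral\<^sup>L lborel (s n) = 0" for n
      unfolding s_def using transl[of "t n *\<^sub>R b"] gei by simp
    ultimately have "integral\<^sup>L lborel (\<lambda>x. b \<bullet> De x) = 0"
      by (simp add: LIMSEQ_const_iff)
    then show ?thesis using De_int by (simp add: inner_commute)
  qed
  then have "integral\<^sup>L lborel De = 0" by (auto intro: euclidean_eqI[of "integral\<^sup>L lborel De"])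
  then show ?thesis by (simp add: set_lebesgue_integral_def De_def[abs_def])
qed

text \<open>In contrast to uniform continuity on \<open>K\<close>, the point \<open>y\<close> may
  leave \<open>K\<close>: mollified values are merely close to a compact set of values. A finite
  cover by balls of half the local radius yields a common \<open>d\<close>.\<close>

lemma uniform_continuity_near_compact:
  fixes f :: "'a::metric_space \<Rightarrow> 'b::metric_space"
  assumes "open S" "compact K" "K \<subseteq> S" "continuous_on S f" "e > 0"
  obtains d where "d > 0" "\<And>x y. x \<in> K \<Longrightarrow> dist x y < d \<Longrightarrow> y \<in> S \<and> dist (f x) (f y) < e"
proof -
  have "\<exists>r>0. \<forall>y. dist x y < 2 * r \<longrightarrow> y \<in> S \<and> dist (f x) (f y) < e / 2" if "x \<in> K" for x
  proof -
    have "x \<in> S" using that assms by auto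
    then obtain r1 where "r1 > 0" "\<And>y. dist y x < r1 \<Longrightarrow> y \<in> S"
      using \<open>open S\<close> unfolding open_dist by blast
    moreover obtain r2 where "r2 > 0" "\<And>y. dist y x < r2 \<Longrightarrow> dist (f y) (f x) < e / 2"
    proof -
      have "isCont f x" using assms \<open>x \<in> S\<close> continuous_on_eq_continuous_at by blast
      then show ?thesis using that half_gt_zero[OF \<open>e > 0\<close>] unfolding continuous_at_eps_delta by blast
    qed
    ultimately show ?thesis
      by (intro exI[of _ "min r1 r2 / 2"]) (auto simp: dist_commute)
  qed
  then obtain r where r: "\<And>x. x \<in> K \<Longrightarrow> r x > 0"
    "\<And>x y. x \<in> K \<Longrightarrow> dist x y < 2 * r x \<Longrightarrow> y \<in> S \<and> dist (f x) (f y) < e / 2"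
    by metis
  obtain C where C: "C \<subseteq> K" "finite C" "K \<subseteq> (\<Union>c\<in>C. ball c (r c))"
    using compactE_image[OF \<open>compact K\<close>, of K "\<lambda>c. ball c (r c)"] r(1)
    by (metis (no_types, lifting) UN_I centre_in_ball open_ball subsetI)
  \<comment> \<open>The extra \<open>1\<close> keeps the minimum meaningful when \<open>K\<close>,
    and with it \<open>C\<close>, is empty.\<close>
  define d where "d = Min (insert 1 (r ` C))"
  have d: "d > 0" using C r(1) by (auto simp: d_def)
  have "y \<in> S \<and> dist (f x) (f y) < e" if "x \<in> K" "dist x y < d" for x y
  proof -
    obtain c where c: "c \<in> C" "dist c x < r c" using C \<open>x \<in> K\<close> by auto
    have "d \<le> r c" using C c by (auto simp: d_def)
    then have "dist c y < 2 * r c" using that c dist_triangle[of c y x] by auto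
    moreover have "dist c x < 2 * r c" using c zero_le_dist[of c x] by linarith
    ultimately have "y \<in> S" "dist (f c) (f x) < e / 2" "dist (f c) (f y) < e / 2"
      using r(2)[of c] c C by auto
    then show ?thesis using dist_triangle_half_r by blast
  qed
  with d show ?thesis by (rule that)
qed

section \<open>Mollifiers\<close>

lemma grad_eq: "GDERIV f x :> D \<Longrightarrow> grad f x = (D :: real^'n)"
  unfolding gderiv_def by (drule frechet_derivative_at[symmetric]) (simp add: grad_def inner_axis' vec_eq_iff)

lemma GDERIV_component: "GDERIV (\<lambda>x::real^'n. x $ i) x :> axis i 1"
  by (simp add: gderiv_def inner_axis bounded_linear_imp_has_derivative bounded_linear_vec_nth)

lemma GDERIV_dot_self: "GDERIV (\<lambda>x. (x - a) \<bullet> (x - a)) x :> 2 *\<^sub>R (x - a)"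
  unfolding gderiv_def by (auto intro!: derivative_eq_intros simp: inner_commute)

text \<open>\<open>flat_exp 0\<close> is the standard smooth function exp(-1/t), flat at 0. With
  negative powers of t as extra factors the family becomes closed, up to linear combinations, under
  differentiation.\<close>

definition flat_exp :: "nat \<Rightarrow> real \<Rightarrow> real" where
  "flat_exp j t = (if t > 0 then exp (- inverse t) * inverse t ^ j else 0)"

lemma DERIV_flat_exp:
  "DERIV (flat_exp j) t :> flat_exp (j + 2) t - real j * flat_exp (j + 1) t"
proof -
  consider "t > 0" | "t < 0" | "t = 0" by linarith
  then show ?thesis
  proof cases
    case 1
    have "DERIV (\<lambda>t. exp (- inverse t) * inverse t ^ j) t :>
        exp (- inverse t) * - (- (inverse t ^ Suc (Suc 0))) * inverse t ^ j +
        real j * (- (inverse t ^ Suc (Suc 0)) * inverse t ^ (j - Suc 0)) * exp (- inverse t)"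
      using 1 by (intro DERIV_mult DERIV_chain2[OF DERIV_exp] DERIV_minus DERIV_power DERIV_inverse) auto
    moreover have "exp (- inverse t) * - (- (inverse t ^ Suc (Suc 0))) * inverse t ^ j +
        real j * (- (inverse t ^ Suc (Suc 0)) * inverse t ^ (j - Suc 0)) * exp (- inverse t)
        = flat_exp (j + 2) t - real j * flat_exp (j + 1) t"
      using 1 by (cases j) (auto simp: flat_exp_def algebra_simps)
    ultimately have "DERIV (\<lambda>t. exp (- inverse t) * inverse t ^ j) t :>
        flat_exp (j + 2) t - real j * flat_exp (j + 1) t" by (rule DERIV_cong)
    then show ?thesis
      by (rule has_field_derivative_transform_within_open[of _ _ _ "{0<..}"])
        (use 1 in \<open>auto simp: flat_exp_def\<close>)
  next
    case 2
    have "DERIV (\<lambda>_. 0) t :> flat_exp (j + 2) t - real j * flat_exp (j + 1) t"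
      using 2 by (simp add: flat_exp_def)
    then show ?thesis
      by (rule has_field_derivative_transform_within_open[of _ _ _ "{..<0}"])
        (use 2 in \<open>auto simp: flat_exp_def\<close>)
  next
    case 3
    \<comment> \<open>At 0 the difference quotient is exp(-1/y) times a power of 1/y, and the
      exponential wins.\<close>
    have "((\<lambda>y. inverse y ^ (j + 1) / exp (inverse y)) \<longlongrightarrow> 0) (at_right (0::real))"
      using filterlim_compose[OF tendsto_power_div_exp_0[of "j+1"] filterlim_inverse_at_top_right] .
    then have R: "((\<lambda>y. flat_exp j y / y) \<longlongrightarrow> 0) (at_right 0)"
      by (rule Lim_transform_eventually)
        (auto simp: eventually_at_right_field flat_exp_def exp_minus field_simps intro!: exI[of _ 1])
    have L: "((\<lambda>y. flat_exp j y / y) \<longlongrightarrow> 0) (at_left 0)"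
      by (rule Lim_transform_eventually[of "\<lambda>_. 0"])
        (auto simp: eventually_at_left_field flat_exp_def intro!: exI[of _ "-1"])
    have "((\<lambda>y. flat_exp j y / y) \<longlongrightarrow> 0) (at 0)"
      using L R filterlim_split_at by blast
    then show ?thesis using 3 by (simp add: DERIV_def flat_exp_def)
  qed
qed

lemma continuous_on_flat_exp: "continuous_on S (flat_exp j)"
  using DERIV_flat_exp DERIV_continuous continuous_at_imp_continuous_on by blast

text \<open>An algebra closed under partial derivatives, so that membership gives
  \<open>Ck_on k\<close> for every \<open>k\<close> by one induction, without formulas for higher
  derivatives. Up to normalisation it contains the kernel centred at \<open>a\<close> of radius sqrt
  c.\<close>

inductive_set bump_algebra :: "real \<Rightarrow> real^'n \<Rightarrow> (real^'n \<Rightarrow> real) set"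
  for c :: real and a :: "real^'n" where
  const: "(\<lambda>x. k) \<in> bump_algebra c a"
| coord: "(\<lambda>x. x $ i) \<in> bump_algebra c a"
| bump: "(\<lambda>x. flat_exp j (c - (x - a) \<bullet> (x - a))) \<in> bump_algebra c a"
| add: "f \<in> bump_algebra c a \<Longrightarrow> g \<in> bump_algebra c a \<Longrightarrow> (\<lambda>x. f x + g x) \<in> bump_algebra c a"
| mult: "f \<in> bump_algebra c a \<Longrightarrow> g \<in> bump_algebra c a \<Longrightarrow> (\<lambda>x. f x * g x) \<in> bump_algebra c a"

lemma bump_algebra_gradient:
  "f \<in> bump_algebra c a \<Longrightarrow>
   \<exists>Df. (\<forall>x. GDERIV f x :> Df x) \<and> (\<forall>i. (\<lambda>x. Df x $ i) \<in> bump_algebra c a)"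
proof (induction rule: bump_algebra.induct)
  case (const k)
  show ?case by (rule exI[of _ "\<lambda>_. 0"]) (auto simp: GDERIV_const intro: bump_algebra.const)
next
  case (coord i)
  show ?case by (rule exI[of _ "\<lambda>_. axis i 1"]) (auto simp: GDERIV_component intro: bump_algebra.const)
next
  case (bump j)
  let ?q = "\<lambda>x. c - (x - a) \<bullet> (x - a)"
  let ?D = "\<lambda>x. (flat_exp (j + 2) (?q x) - real j * flat_exp (j + 1) (?q x)) *\<^sub>R (0 - 2 *\<^sub>R (x - a))"
  have "GDERIV (\<lambda>x. flat_exp j (?q x)) x :> ?D x" for x
    by (rule GDERIV_DERIV_compose[OF GDERIV_diff[OF GDERIV_const GDERIV_dot_self] DERIV_flat_exp])
  moreover have "(\<lambda>x. ?D x $ i) \<in> bump_algebra c a" for i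
  proof -
    have "(\<lambda>x. (flat_exp (j + 2) (?q x) + (- real j) * flat_exp (j + 1) (?q x)) * ((-2) * (x $ i + (- (a $ i)))))
        \<in> bump_algebra c a"
      by (intro bump_algebra.intros)
    then show ?thesis by (simp add: algebra_simps)
  qed
  ultimately show ?case by (intro exI[of _ ?D]) blast
next
  case (add f g)
  then obtain Df Dg where "\<And>x. GDERIV f x :> Df x" "\<And>i. (\<lambda>x. Df x $ i) \<in> bump_algebra c a"
    "\<And>x. GDERIV g x :> Dg x" "\<And>i. (\<lambda>x. Dg x $ i) \<in> bump_algebra c a" by blast
  then show ?case
    by (intro exI[of _ "\<lambda>x. Df x + Dg x"]) (auto intro: GDERIV_add bump_algebra.add)
next
  case (mult f g)
  then obtain Df Dg where "\<And>x. GDERIV f x :> Df x" "\<And>i. (\<lambda>x. Df x $ i) \<in> bump_algebra c a"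
    "\<And>x. GDERIV g x :> Dg x" "\<And>i. (\<lambda>x. Dg x $ i) \<in> bump_algebra c a" by blast
  then show ?case using mult.hyps
    by (intro exI[of _ "\<lambda>x. f x *\<^sub>R Dg x + g x *\<^sub>R Df x"])
      (auto intro!: GDERIV_mult bump_algebra.add bump_algebra.mult)
qed

lemma bump_algebra_Ck_on: "f \<in> bump_algebra c a \<Longrightarrow> Ck_on k UNIV f"
proof (induction k arbitrary: f)
  case 0
  then obtain Df where "\<And>x. GDERIV f x :> Df x" using bump_algebra_gradient by blast
  then show ?case unfolding gderiv_def Ck_on.simps
    by (meson has_derivative_continuous continuous_at_imp_continuous_on)
next
  case (Suc k)
  then obtain Df where D: "\<And>x. GDERIV f x :> Df x" "\<And>i. (\<lambda>x. Df x $ i) \<in> bump_algebra c a"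
    using bump_algebra_gradient by blast
  have "f differentiable (at x)" for x using D(1) unfolding gderiv_def differentiable_def by blast
  moreover have "grad f = Df" using D(1) grad_eq by blast
  ultimately show ?case using Suc.IH D(2) by simp
qed

text \<open>The kernel has two uses: as a test function in the weak equation, and as the carrier of
  three derivatives of the mollified solution, which are therefore given explicitly.
  \<open>D\<close> is to vanish off the ball too, because its components serve as kernels in an
  integration by parts.\<close>

lemma mollifier_kernel_exists:
  fixes \<epsilon> :: real
  assumes "\<epsilon> > 0"
  obtains \<rho> :: "real^'n \<Rightarrow> real" and D D2 D3 where
    "\<And>z. \<rho> z \<ge> 0" "\<And>z. norm z \<ge> \<epsilon> \<Longrightarrow> \<rho> z = 0"
    "\<And>z. norm z \<ge> \<epsilon> \<Longrightarrow> D z = 0"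
    "\<And>x. integrable lborel (\<lambda>y. \<rho> (x - y))"
    "\<And>x. (LINT y|lborel. \<rho> (x - y)) = 1"
    "\<And>x \<Omega>. cball x \<epsilon> \<subseteq> \<Omega> \<Longrightarrow> test_function \<Omega> (\<lambda>y. \<rho> (x - y))"
    "\<And>z. GDERIV \<rho> z :> D z"
    "\<And>z i. GDERIV (\<lambda>z. D z $ i) z :> D2 z $ i"
    "\<And>z i j. GDERIV (\<lambda>z. D2 z $ i $ j) z :> D3 z $ i $ j"
    "continuous_on UNIV D3"
    "\<And>z i j. D2 z $ i $ j = D2 z $ j $ i"
    "\<And>z i j k. D3 z $ i $ j $ k = D3 z $ i $ k $ j"
proof -
  define q where "q z = \<epsilon>\<^sup>2 - z \<bullet> z" for z :: "real^'n"
  define b where "b z = flat_exp 0 (q z)" for z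
  have Dq: "GDERIV q z :> (-2) *\<^sub>R z" for z
    using GDERIV_diff[OF GDERIV_const GDERIV_dot_self[of 0]] by (simp add: q_def[abs_def])
  have q_cont: "continuous_on S q" for S unfolding q_def by (intro continuous_intros)
  have bC: "continuous_on S b" for S
    unfolding b_def by (rule continuous_on_compose2[OF continuous_on_flat_exp[of UNIV] q_cont]) auto
  have q0: "q z \<le> 0" if "norm z \<ge> \<epsilon>" for z
  proof -
    have "\<epsilon>\<^sup>2 \<le> (norm z)\<^sup>2" using that assms by (intro power_mono) auto
    then show ?thesis by (simp add: q_def dot_square_norm)
  qed
  then have b0: "b z = 0" if "norm z \<ge> \<epsilon>" for z
    using that by (fastforce simp: b_def flat_exp_def)
  have b_nonneg: "b z \<ge> 0" for z by (simp add: b_def flat_exp_def)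
  have b_int: "integrable lborel b"
  proof -
    have "integrable lborel (\<lambda>z. indicator (cball 0 \<epsilon>) z *\<^sub>R b z)"
      by (rule borel_integrable_compact) (auto intro: bC)
    moreover have "(\<lambda>z. indicator (cball 0 \<epsilon>) z *\<^sub>R b z) = b"
      using b0 by (auto simp: fun_eq_iff indicator_def)
    ultimately show ?thesis by simp
  qed
  define I where "I = integral\<^sup>L lborel b"
  have "I > 0"
  proof -
    have "I \<noteq> 0"
    proof
      assume "I = 0"
      then have "AE z in lborel. b z = 0"
        using integral_nonneg_eq_0_iff_AE[OF b_int] b_nonneg by (simp add: I_def)
      moreover have "z \<notin> ball 0 \<epsilon>" if "b z = 0" for z
      proof
        assume "z \<in> ball 0 \<epsilon>"
        then have "(norm z)\<^sup>2 < \<epsilon>\<^sup>2" by (intro power_strict_mono) auto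
        then have "q z > 0" by (simp add: q_def dot_square_norm)
        then show False using that by (simp add: b_def flat_exp_def)
      qed
      ultimately have "AE z :: real^'n in lborel. z \<notin> ball 0 \<epsilon>" by (rule eventually_mono)
      then have "emeasure lborel (ball 0 \<epsilon> :: (real^'n) set) = 0"
        by (subst (asm) AE_iff_measurable[of "ball 0 \<epsilon>"]) auto
      then show False
        using emeasure_lborel_ball_finite content_ball_pos[OF assms, of "0::real^'n"] by (simp add: measure_def)
    qed
    moreover have "I \<ge> 0" unfolding I_def using b_nonneg by simp
    ultimately show ?thesis by simp
  qed
  \<comment> \<open>The kernel is even, so y \<mapsto> b(x - y) is a translate of \<open>b\<close>,
    and translation invariance gives its integral.\<close>
  let ?s = "\<lambda>x y. (- x) + y :: real^'n"
  have shift: "b (x - y) = b (?s x y)" for x y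
    by (simp add: b_def q_def algebra_simps inner_commute)
  have i: "integrable lborel (\<lambda>y. b (x - y))" "(LINT y|lborel. b (x - y)) = I" for x
    unfolding shift using lborel_integral_translate[OF b_int, of "- x"] by (simp_all add: I_def)
  define \<rho> where "\<rho> z = b z / I" for z
  \<comment> \<open>\<open>b1\<close>, \<open>b2\<close>, \<open>b3\<close> are the first three
    derivatives of t \<mapsto> flat_exp 0 t / I, computed from the recursion
    \<open>DERIV_flat_exp\<close>.\<close>
  define b1 where "b1 t = flat_exp 2 t / I" for t
  define b2 where "b2 t = (flat_exp 4 t - 2 * flat_exp 3 t) / I" for t
  define b3 where "b3 t = (flat_exp 6 t - 6 * flat_exp 5 t + 6 * flat_exp 4 t) / I" for t
  have d0: "DERIV (\<lambda>t. flat_exp 0 t / I) t :> b1 t" for t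
    unfolding b1_def using DERIV_cdivide[OF DERIV_flat_exp[of 0]] by (simp add: numeral_2_eq_2)
  have d1: "DERIV b1 t :> b2 t" for t
    unfolding b1_def b2_def using DERIV_cdivide[OF DERIV_flat_exp[of 2]] by (simp add: eval_nat_numeral)
  have d2: "DERIV b2 t :> b3 t" for t
  proof -
    have "DERIV b2 t :> ((flat_exp (4+2) t - real 4 * flat_exp (4+1) t) -
       2 * (flat_exp (3+2) t - real 3 * flat_exp (3+1) t)) / I"
      unfolding b2_def by (intro DERIV_cdivide DERIV_diff DERIV_cmult DERIV_flat_exp)
    moreover have "((flat_exp (4+2) t - real 4 * flat_exp (4+1) t) -
       2 * (flat_exp (3+2) t - real 3 * flat_exp (3+1) t)) / I = b3 t"
      by (simp add: b3_def)
    ultimately show ?thesis by simp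
  qed
  have c3: "continuous_on S b3" for S
    unfolding b3_def using \<open>I > 0\<close>
    by (intro continuous_intros continuous_on_flat_exp[THEN continuous_on_subset]) auto
  have c2: "continuous_on S b2" for S
    using d2 DERIV_continuous continuous_at_imp_continuous_on by blast
  define \<delta> where "\<delta> i j = (if i = j then 1 else 0 :: real)" for i j :: 'n
  define D where "D z = (-2 * b1 (q z)) *\<^sub>R z" for z
  define D2 where "D2 z = (\<chi> i j. 4 * b2 (q z) * (z $ i * z $ j) - 2 * \<delta> i j * b1 (q z))" for z
  define D3 where "D3 z = (\<chi> i j k. - 8 * b3 (q z) * (z $ i * z $ j * z $ k)
     + 4 * b2 (q z) * (\<delta> i k * z $ j + \<delta> j k * z $ i + \<delta> i j * z $ k))" for z
  have g0: "GDERIV \<rho> z :> D z" for z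
    using GDERIV_DERIV_compose[OF Dq d0, of z] by (simp add: \<rho>_def[abs_def] b_def D_def mult.commute)
  have ax: "axis i (1::real) $ j = \<delta> i j" for i j by (simp add: axis_def \<delta>_def)
  have g1: "GDERIV (\<lambda>z. D z $ i) z :> D2 z $ i" for z i
  proof -
    have "GDERIV (\<lambda>z. (-2 * b1 (q z)) * z $ i) z :>
      (-2 * b1 (q z)) *\<^sub>R axis i 1 + (z $ i) *\<^sub>R ((-2) *\<^sub>R (b2 (q z) *\<^sub>R (-2) *\<^sub>R z) + b1 (q z) *\<^sub>R 0)"
      by (intro GDERIV_mult GDERIV_component GDERIV_const GDERIV_DERIV_compose[OF Dq d1])
    then show ?thesis unfolding D_def vector_scaleR_component real_scaleR_def
      by (rule GDERIV_subst) (simp add: vec_eq_iff D2_def ax algebra_simps)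
  qed
  have g2: "GDERIV (\<lambda>z. D2 z $ i $ j) z :> D3 z $ i $ j" for z i j
  proof -
    have "GDERIV (\<lambda>z. (4 * b2 (q z)) * (z $ i * z $ j) - (2 * \<delta> i j) * b1 (q z)) z :>
      ((4 * b2 (q z)) *\<^sub>R ((z $ i) *\<^sub>R axis j 1 + (z $ j) *\<^sub>R axis i 1)
       + (z $ i * z $ j) *\<^sub>R (4 *\<^sub>R (b3 (q z) *\<^sub>R (-2) *\<^sub>R z) + b2 (q z) *\<^sub>R 0))
       - ((2 * \<delta> i j) *\<^sub>R (b2 (q z) *\<^sub>R (-2) *\<^sub>R z) + b1 (q z) *\<^sub>R 0)"
      by (intro GDERIV_diff GDERIV_mult GDERIV_component GDERIV_const
          GDERIV_DERIV_compose[OF Dq d1] GDERIV_DERIV_compose[OF Dq d2])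
    then show ?thesis unfolding D2_def vec_lambda_beta
      by (rule GDERIV_subst) (simp add: vec_eq_iff D3_def ax algebra_simps)
  qed
  have cont3: "continuous_on UNIV D3"
    unfolding D3_def
    by (intro continuous_on_vec_lambda continuous_intros continuous_on_compose2[OF c3[of UNIV] q_cont]
        continuous_on_compose2[OF c2[of UNIV] q_cont]) auto
  have test: "test_function \<Omega> (\<lambda>y. \<rho> (x - y))" if "cball x \<epsilon> \<subseteq> \<Omega>" for x \<Omega>
  proof -
    have "(\<lambda>y. flat_exp 0 (\<epsilon>\<^sup>2 - (y - x) \<bullet> (y - x)) * inverse I) \<in> bump_algebra (\<epsilon>\<^sup>2) x"
      by (intro bump_algebra.intros)
    moreover have "(\<lambda>y. flat_exp 0 (\<epsilon>\<^sup>2 - (y - x) \<bullet> (y - x)) * inverse I) = (\<lambda>y. \<rho> (x - y))"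
      by (simp add: \<rho>_def b_def q_def fun_eq_iff divide_inverse algebra_simps inner_commute)
    ultimately have "Ck_on k UNIV (\<lambda>y. \<rho> (x - y))" for k using bump_algebra_Ck_on by metis
    moreover have "closure {y. \<rho> (x - y) \<noteq> 0} \<subseteq> cball x \<epsilon>"
      by (rule closure_minimal) (use b0 in \<open>force simp: \<rho>_def dist_norm\<close>, simp)
    ultimately show ?thesis using that
      by (auto simp: test_function_def intro: compact_closure[THEN iffD2] bounded_subset[OF bounded_cball]
          dest: order_trans[OF closure_subset])
  qed
  show thesis
  proof (rule that[of \<rho> D D2 D3])
    show "(LINT y|lborel. \<rho> (x - y)) = 1" for x using i(2)[of x] \<open>I > 0\<close> by (simp add: \<rho>_def)
    show "\<rho> z \<ge> 0" for z using b_nonneg \<open>I > 0\<close> by (simp add: \<rho>_def)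
    show "\<rho> z = 0" if "norm z \<ge> \<epsilon>" for z using b0 that by (simp add: \<rho>_def)
    show "D z = 0" if "norm z \<ge> \<epsilon>" for z using q0[OF that] by (simp add: D_def b1_def flat_exp_def)
    show "integrable lborel (\<lambda>y. \<rho> (x - y))" for x using i(1) by (simp add: \<rho>_def)
    show "D2 z $ i $ j = D2 z $ j $ i" for z i j by (auto simp: D2_def \<delta>_def mult_ac)
    show "D3 z $ i $ j $ k = D3 z $ i $ k $ j" for z i j k
      by (auto simp: D3_def \<delta>_def mult_ac add_ac)
  qed (use g0 g1 g2 cont3 test in auto)
qed

section \<open>Mollified solutions\<close>

lemma GDERIV_grad:
  assumes "f differentiable (at (x :: real^'n))"
  shows "GDERIV f x :> grad f x"
proof -
  let ?f' = "frechet_derivative f (at x)"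
  have D: "(f has_derivative ?f') (at x)" using assms frechet_derivative_works by blast
  have lin: "linear ?f'" using D has_derivative_linear by blast
  have "?f' h = h \<bullet> grad f x" for h
  proof -
    have "?f' h = ?f' (\<Sum>i\<in>UNIV. (h $ i) *\<^sub>R axis i 1)"
      using basis_expansion[of h] by (simp add: scalar_mult_eq_scaleR)
    also have "\<dots> = (\<Sum>i\<in>UNIV. h $ i * ?f' (axis i 1))"
      by (simp add: linear_sum[OF lin] linear_scale[OF lin])
    finally show ?thesis by (simp add: inner_vec_def grad_def)
  qed
  then have "?f' = (\<lambda>h. h \<bullet> grad f x)" by blast
  then show ?thesis using D unfolding gderiv_def by simp
qed

lemma GDERIV_imp_continuous_on:
  "(\<And>x. x \<in> S \<Longrightarrow> GDERIV f x :> Df x) \<Longrightarrow> continuous_on S f"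
  unfolding gderiv_def by (meson has_derivative_continuous continuous_at_imp_continuous_on)

lemma continuous_on_components:
  fixes f :: "'a::topological_space \<Rightarrow> ('b::topological_space)^'n"
  assumes "\<And>i. continuous_on S (\<lambda>x. f x $ i)"
  shows "continuous_on S f"
proof -
  have "continuous_on S (\<lambda>x. \<chi> i. f x $ i)" using assms by (intro continuous_on_vec_lambda)
  then show ?thesis by simp
qed

lemma Ck_on_1D:
  assumes "Ck_on 1 S f"
  shows "x \<in> S \<Longrightarrow> GDERIV f x :> grad f x" "continuous_on S f" "continuous_on S (grad f)"
proof -
  show "GDERIV f x :> grad f x" if "x \<in> S" for x
    using assms that by (intro GDERIV_grad) (auto simp: numeral_eq_Suc)
  then show "continuous_on S f" by (rule GDERIV_imp_continuous_on)
  show "continuous_on S (grad f)"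
    by (rule continuous_on_components) (use assms in auto)
qed

text \<open>The derivative falls on the kernel, so a merely continuous \<open>w\<close> is enough
  and the lemma can be iterated with \<open>\<sigma>\<close> a partial derivative of the kernel.
  Integrating over a fixed box defines the mollification on the whole space although
  \<open>w\<close> is controlled on the box only.\<close>

lemma GDERIV_convolution:
  fixes w :: "'a::euclidean_space \<Rightarrow> real"
  assumes w: "continuous_on (cbox a b) w"
    and \<sigma>: "\<And>z. GDERIV \<sigma> z :> D z" and D: "continuous_on UNIV D"
  shows "GDERIV (\<lambda>x. integral (cbox a b) (\<lambda>y. w y * \<sigma> (x - y))) x :>
    integral (cbox a b) (\<lambda>y. w y *\<^sub>R D (x - y))"
proof -
  let ?f = "\<lambda>x y. w y * \<sigma> (x - y)"
  let ?v = "\<lambda>x y. w y *\<^sub>R D (x - y)"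
  have cs: "continuous_on UNIV \<sigma>" using \<sigma> by (rule GDERIV_imp_continuous_on)
  have cv: "continuous_on (cbox a b) (?v x)" for x
    by (intro continuous_intros w continuous_on_compose2[OF D]) auto
  have "((\<lambda>x. integral (cbox a b) (?f x)) has_derivative
      integral (cbox a b) (\<lambda>y. blinfun_inner_left (?v x y))) (at x within UNIV)"
  proof (rule leibniz_rule)
    fix x y
    have "((\<lambda>x. \<sigma> (x - y)) has_derivative (\<lambda>h. h \<bullet> D (x - y))) (at x)"
      using \<sigma>[of "x - y"] unfolding gderiv_def
      by (intro has_derivative_compose[of "\<lambda>x. x - y" _ _ _ \<sigma>, simplified])
        (auto intro!: derivative_eq_intros)
    then show "((\<lambda>x. ?f x y) has_derivative blinfun_apply (blinfun_inner_left (?v x y))) (at x within UNIV)"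
      by (auto intro!: derivative_eq_intros)
  next
    show "?f x integrable_on cbox a b" for x
      by (intro integrable_continuous continuous_intros w continuous_on_compose2[OF cs]) auto
    show "continuous_on (UNIV \<times> cbox a b) (\<lambda>(x, y). blinfun_inner_left (?v x y))"
      unfolding split_beta
      by (intro continuous_intros bounded_linear.continuous_on[OF bounded_linear_blinfun_inner_left]
          continuous_on_compose2[OF w] continuous_on_compose2[OF D]) auto
  qed auto
  moreover have "integral (cbox a b) (\<lambda>y. blinfun_inner_left (?v x y)) =
      blinfun_inner_left (integral (cbox a b) (?v x))"
    using integral_linear[OF integrable_continuous[OF cv] bounded_linear_blinfun_inner_left]
    by (simp add: o_def)
  ultimately show ?thesis by (simp add: gderiv_def)
qed

text \<open>For \<open>x\<close> so deep inside the box that y \<mapsto> \<sigma>(x - y) vanishes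
  off it, the gradient of u(y) \<sigma>(x - y) has integral zero. This moves one derivative from the
  kernel to \<open>u\<close>; it is applied to the kernel and to its first partial
  derivatives.\<close>

lemma integral_convolution_gradient_by_parts:
  fixes u :: "'a::euclidean_space \<Rightarrow> real"
  assumes S: "open S" "cbox a b \<subseteq> S" "cball x \<epsilon> \<subseteq> cbox a b"
    and u: "\<And>y. y \<in> S \<Longrightarrow> GDERIV u y :> Du y" "continuous_on S Du"
    and \<sigma>: "\<And>z. GDERIV \<sigma> z :> D z" "continuous_on UNIV D"
    and zero: "\<And>z. norm z \<ge> \<epsilon> \<Longrightarrow> \<sigma> z = 0"
  shows "integral (cbox a b) (\<lambda>y. u y *\<^sub>R D (x - y)) = integral (cbox a b) (\<lambda>y. \<sigma> (x - y) *\<^sub>R Du y)"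
proof -
  have cs: "continuous_on UNIV \<sigma>" using \<sigma>(1) by (rule GDERIV_imp_continuous_on)
  have cu: "continuous_on S u" using u(1) by (rule GDERIV_imp_continuous_on)
  let ?A = "\<lambda>y. u y *\<^sub>R D (x - y)" and ?B = "\<lambda>y. \<sigma> (x - y) *\<^sub>R Du y"
  have cA: "continuous_on S ?A" by (intro continuous_intros cu continuous_on_compose2[OF \<sigma>(2)]) auto
  have cB: "continuous_on S ?B" by (intro continuous_intros u(2) continuous_on_compose2[OF cs]) auto
  have der: "GDERIV (\<lambda>y. u y * \<sigma> (x - y)) y :> ?B y - ?A y" if "y \<in> S" for y
  proof -
    have "((\<lambda>y. \<sigma> (x - y)) has_derivative (\<lambda>h. (- h) \<bullet> D (x - y))) (at y)"
      using \<sigma>(1)[of "x - y"] unfolding gderiv_def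
      by (intro has_derivative_compose[of "\<lambda>y. x - y" "\<lambda>h. - h" _ _ \<sigma>, simplified])
        (auto intro!: derivative_eq_intros)
    then have "GDERIV (\<lambda>y. \<sigma> (x - y)) y :> - D (x - y)" by (simp add: gderiv_def)
    from GDERIV_mult[OF u(1)[OF that] this] show ?thesis by (rule GDERIV_subst) simp
  qed
  have "(LINT y:cbox a b|lborel. ?B y - ?A y) = 0"
  proof (rule set_integral_gradient_eq_0[OF S(1) compact_cbox S(2) der])
    show "u y * \<sigma> (x - y) = 0" if "y \<in> S" "y \<notin> cbox a b" for y
    proof -
      have "y \<notin> cball x \<epsilon>" using that S(3) by blast
      then show ?thesis using zero[of "x - y"] by (simp add: dist_norm)
    qed
  qed (auto intro!: continuous_intros cA cB)
  moreover have "set_integrable lborel (cbox a b) (\<lambda>y. ?B y - ?A y)"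
    unfolding set_integrable_def
    by (intro borel_integrable_compact compact_cbox continuous_intros
        continuous_on_subset[OF cA S(2)] continuous_on_subset[OF cB S(2)])
  ultimately have "integral (cbox a b) (\<lambda>y. ?B y - ?A y) = 0"
    using set_borel_integral_eq_integral(2) by metis
  moreover have "integral (cbox a b) (\<lambda>y. ?B y - ?A y) = integral (cbox a b) ?B - integral (cbox a b) ?A"
    by (intro Henstock_Kurzweil_Integration.integral_diff integrable_continuous
        continuous_on_subset[OF cA S(2)] continuous_on_subset[OF cB S(2)])
  ultimately show ?thesis by simp
qed

text \<open>Measurability is asked of the product alone: for the source it is known on compact
  subsets of the domain, and that is where the weight lives.\<close>

lemma norm_average_diff_le:
  fixes g :: "'a \<Rightarrow> 'b::euclidean_space"
  assumes w: "integrable M w" "(LINT y|M. w y) = 1" "\<And>y. w y \<ge> (0::real)"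
    and g: "(\<lambda>y. w y *\<^sub>R g y) \<in> borel_measurable M"
    and le: "\<And>y. w y \<noteq> 0 \<Longrightarrow> norm (g y - c) \<le> \<delta>"
  shows "norm ((LINT y|M. w y *\<^sub>R g y) - c) \<le> \<delta>"
proof -
  have "norm (w y *\<^sub>R (g y - c)) \<le> w y * \<delta>" for y
    using le[of y] w(3)[of y] by (cases "w y = 0") (auto intro: mult_left_mono)
  note bound = this
  have "(\<lambda>y. w y *\<^sub>R g y - w y *\<^sub>R c) \<in> borel_measurable M"
    using w(1) by (intro borel_measurable_diff[OF g] borel_measurable_scaleR) auto
  then have meas: "(\<lambda>y. w y *\<^sub>R (g y - c)) \<in> borel_measurable M" by (simp add: scaleR_diff_right)
  have i1: "integrable M (\<lambda>y. w y *\<^sub>R (g y - c))"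
    by (rule Bochner_Integration.integrable_bound[of _ "\<lambda>y. w y * \<delta>"])
      (use w meas bound in \<open>auto intro!: AE_I2 order_trans[OF bound] simp del: norm_scaleR\<close>)
  have i2: "integrable M (\<lambda>y. w y *\<^sub>R c)" using w by simp
  have "(LINT y|M. w y *\<^sub>R (g y - c) + w y *\<^sub>R c) = (LINT y|M. w y *\<^sub>R (g y - c)) + (LINT y|M. w y *\<^sub>R c)"
    using i1 i2 by (rule Bochner_Integration.integral_add)
  moreover have "(LINT y|M. w y *\<^sub>R c) = c" using w by simp
  ultimately have "(LINT y|M. w y *\<^sub>R g y) - c = (LINT y|M. w y *\<^sub>R (g y - c))"
    by (simp add: scaleR_diff_right)
  also have "norm \<dots> \<le> (LINT y|M. norm (w y *\<^sub>R (g y - c)))" by (rule integral_norm_bound)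
  also have "\<dots> \<le> (LINT y|M. w y * \<delta>)"
    using w by (intro integral_mono bound integrable_norm[OF i1]) auto
  also have "\<dots> = \<delta>" using w by simp
  finally show ?thesis .
qed

text \<open>The last bound is the weak equation itself: tested with y \<mapsto> \<rho>(x - y), it
  says that minus the Laplacian of \<open>U\<close> at \<open>x\<close> is a weighted mean of the
  source near \<open>x\<close>. Each bound refers to the oscillation on a single \<epsilon>-ball, so
  the source can be handled near points where \<open>grad u\<close> is nonzero and ignored
  elsewhere.\<close>

lemma mollified_solution_exists:
  fixes u :: "real^'n \<Rightarrow> real"
  assumes \<Omega>: "open \<Omega>" "cbox a b \<subseteq> \<Omega>" and "\<epsilon> > 0"
    and sol: "positive_weak_solution p q \<Omega> u"
  obtains U :: "real^'n \<Rightarrow> real" and DU D2U D3U where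
    "\<And>x. GDERIV U x :> DU x"
    "\<And>x i. GDERIV (\<lambda>x. DU x $ i) x :> D2U x $ i"
    "\<And>x i j. GDERIV (\<lambda>x. D2U x $ i $ j) x :> D3U x $ i $ j"
    "continuous_on UNIV D3U"
    "\<And>x i j. D2U x $ i $ j = D2U x $ j $ i"
    "\<And>x i j k. D3U x $ i $ j $ k = D3U x $ i $ k $ j"
    "\<And>x \<delta>. cball x \<epsilon> \<subseteq> cbox a b \<Longrightarrow> (\<And>y. dist x y < \<epsilon> \<Longrightarrow> dist (u x) (u y) \<le> \<delta>) \<Longrightarrow>
      dist (u x) (U x) \<le> \<delta>"
    "\<And>x \<delta>. cball x \<epsilon> \<subseteq> cbox a b \<Longrightarrow> (\<And>y. dist x y < \<epsilon> \<Longrightarrow> dist (grad u x) (grad u y) \<le> \<delta>) \<Longrightarrow>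
      dist (grad u x) (DU x) \<le> \<delta>"
    "\<And>x \<delta> c. cball x \<epsilon> \<subseteq> cbox a b \<Longrightarrow>
      (\<And>y. dist x y < \<epsilon> \<Longrightarrow> dist c (enn2real (source p q u y)) \<le> \<delta>) \<Longrightarrow>
      dist c (- (\<Sum>i\<in>UNIV. D2U x $ i $ i)) \<le> \<delta>"
proof -
  obtain \<rho> :: "real^'n \<Rightarrow> real" and D D2 D3 where \<rho>:
    "\<And>z. \<rho> z \<ge> 0" "\<And>z. norm z \<ge> \<epsilon> \<Longrightarrow> \<rho> z = 0" "\<And>z. norm z \<ge> \<epsilon> \<Longrightarrow> D z = 0"
    "\<And>x. integrable lborel (\<lambda>y. \<rho> (x - y))"
    "\<And>x. (LINT y|lborel. \<rho> (x - y)) = 1"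
    "\<And>x \<Omega>. cball x \<epsilon> \<subseteq> \<Omega> \<Longrightarrow> test_function \<Omega> (\<lambda>y. \<rho> (x - y))"
    and d1: "\<And>z. GDERIV \<rho> z :> D z"
    and d2: "\<And>z i. GDERIV (\<lambda>z. D z $ i) z :> D2 z $ i"
    and d3: "\<And>z i j. GDERIV (\<lambda>z. D2 z $ i $ j) z :> D3 z $ i $ j"
    and c3: "continuous_on UNIV D3"
    and sym: "\<And>z i j. D2 z $ i $ j = D2 z $ j $ i"
    "\<And>z i j k. D3 z $ i $ j $ k = D3 z $ i $ k $ j"
    by (rule mollifier_kernel_exists[OF \<open>\<epsilon> > 0\<close>]) (rule that; assumption)
  have c2: "continuous_on UNIV D2"
    by (intro continuous_on_components) (rule GDERIV_imp_continuous_on[OF d3])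
  have c1: "continuous_on UNIV D"
    by (intro continuous_on_components) (rule GDERIV_imp_continuous_on[OF d2])
  have c0: "continuous_on UNIV \<rho>" by (rule GDERIV_imp_continuous_on[OF d1])
  have C1: "Ck_on 1 \<Omega> u" using sol by (simp add: positive_weak_solution_def)
  note u = Ck_on_1D[OF C1]
  let ?Q = "cbox a b"
  have uQ: "continuous_on ?Q u" using u(2) \<Omega> continuous_on_subset by blast
  define U where "U x = integral ?Q (\<lambda>y. u y * \<rho> (x - y))" for x
  define DU where "DU x = integral ?Q (\<lambda>y. u y *\<^sub>R D (x - y))" for x
  define D2U where "D2U x = (\<chi> i. integral ?Q (\<lambda>y. u y *\<^sub>R D2 (x - y) $ i))" for x
  define D3U where "D3U x = (\<chi> i j. integral ?Q (\<lambda>y. u y *\<^sub>R D3 (x - y) $ i $ j))" for x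
  have conv_cont: "continuous_on S (\<lambda>y. u y *\<^sub>R F (x - y))"
    if "continuous_on UNIV F" "S \<subseteq> \<Omega>" for F :: "real^'n \<Rightarrow> 'b::real_normed_vector" and x S
    using that by (intro continuous_intros continuous_on_subset[OF u(2)] continuous_on_compose2[OF that(1)]) auto
  have int: "(\<lambda>y. u y *\<^sub>R F (x - y)) integrable_on ?Q"
    if "continuous_on UNIV F" for F :: "real^'n \<Rightarrow> 'b::banach" and x
    using conv_cont[OF that \<Omega>(2)] by (rule integrable_continuous)
  have comp: "integral ?Q (\<lambda>y. u y *\<^sub>R F (x - y)) $ i = integral ?Q (\<lambda>y. u y * F (x - y) $ i)"
    if "continuous_on UNIV F" for F :: "real^'n \<Rightarrow> real^'n" and x i
    using integral_component_eq_cart[OF int[OF that, of x], of i] by simp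
  have c2i: "continuous_on UNIV (\<lambda>z. D2 z $ i)" for i using c2 by (intro continuous_intros)
  have c3ij: "continuous_on UNIV (\<lambda>z. D3 z $ i $ j)" for i j using c3 by (intro continuous_intros)
  have g0: "GDERIV U x :> DU x" for x
    unfolding U_def DU_def by (rule GDERIV_convolution[OF uQ d1 c1])
  have g1: "GDERIV (\<lambda>x. DU x $ i) x :> D2U x $ i" for x i
    unfolding DU_def D2U_def comp[OF c1] vec_lambda_beta by (rule GDERIV_convolution[OF uQ d2 c2i])
  have g2: "GDERIV (\<lambda>x. D2U x $ i $ j) x :> D3U x $ i $ j" for x i j
    unfolding D2U_def D3U_def vec_lambda_beta comp[OF c2i] by (rule GDERIV_convolution[OF uQ d3 c3ij])
  have cont3: "continuous_on UNIV D3U"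
    unfolding D3U_def
  proof (intro continuous_on_vec_lambda integral_continuous_on_param)
    fix i j
    show "continuous_on (UNIV \<times> ?Q) (\<lambda>(x, y). u y *\<^sub>R D3 (x - y) $ i $ j)"
      unfolding split_beta
      by (intro continuous_intros continuous_on_compose2[OF uQ] continuous_on_compose2[OF c3]) auto
  qed
  have sym2: "D2U x $ i $ j = D2U x $ j $ i" for x i j
    unfolding D2U_def vec_lambda_beta comp[OF c2i] by (simp add: sym(1))
  have sym3: "D3U x $ i $ j $ k = D3U x $ i $ k $ j" for x i j k
    unfolding D3U_def vec_lambda_beta comp[OF c3ij] by (simp add: sym(2))
  have restrict: "(LINT y:T|lborel. F y) = (LINT y|lborel. F y)"
    if "cball x \<epsilon> \<subseteq> T" "\<And>y. norm (x - y) \<ge> \<epsilon> \<Longrightarrow> F y = 0" for F :: "real^'n \<Rightarrow> 'b::euclidean_space" and x T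
  proof -
    have "indicator T y *\<^sub>R F y = F y" for y
      using that by (cases "y \<in> cball x \<epsilon>") (auto simp: dist_norm indicator_def)
    then show ?thesis by (simp add: set_lebesgue_integral_def)
  qed
  have HK: "integral ?Q F = (LINT y:?Q|lborel. F y)" "integrable lborel (\<lambda>y. indicator ?Q y *\<^sub>R F y)"
    if "continuous_on ?Q F" for F :: "real^'n \<Rightarrow> 'b::euclidean_space"
  proof -
    show "integrable lborel (\<lambda>y. indicator ?Q y *\<^sub>R F y)"
      using borel_integrable_compact[OF compact_cbox that] .
    then show "integral ?Q F = (LINT y:?Q|lborel. F y)"
      using set_borel_integral_eq_integral(2)[of ?Q F] by (simp add: set_integrable_def)
  qed
  have average: "dist c (integral ?Q (\<lambda>y. \<rho> (x - y) *\<^sub>R g y)) \<le> \<delta>"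
    if g: "continuous_on ?Q g" and x: "cball x \<epsilon> \<subseteq> ?Q"
      and le: "\<And>y. dist x y < \<epsilon> \<Longrightarrow> dist c (g y) \<le> \<delta>" for x c \<delta> and g :: "real^'n \<Rightarrow> 'b::euclidean_space"
  proof -
    have cont: "continuous_on ?Q (\<lambda>y. \<rho> (x - y) *\<^sub>R g y)"
      by (intro continuous_intros g continuous_on_compose2[OF c0]) auto
    have z: "\<rho> (x - y) *\<^sub>R g y = 0" if "norm (x - y) \<ge> \<epsilon>" for y using \<rho>(2)[OF that] by simp
    have "integral ?Q (\<lambda>y. \<rho> (x - y) *\<^sub>R g y) = (LINT y|lborel. \<rho> (x - y) *\<^sub>R g y)"
      using HK(1)[OF cont] restrict[OF x z] by simp
    moreover have "norm ((LINT y|lborel. \<rho> (x - y) *\<^sub>R g y) - c) \<le> \<delta>"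
    proof (rule norm_average_diff_le)
      have "indicator ?Q y *\<^sub>R (\<rho> (x - y) *\<^sub>R g y) = \<rho> (x - y) *\<^sub>R g y" for y
        using x z[of y] by (cases "y \<in> cball x \<epsilon>") (auto simp: dist_norm indicator_def)
      then show "(\<lambda>y. \<rho> (x - y) *\<^sub>R g y) \<in> borel_measurable lborel"
        using borel_measurable_integrable[OF HK(2)[OF cont]] by (simp del: scaleR_scaleR)
      show "norm (g y - c) \<le> \<delta>" if "\<rho> (x - y) \<noteq> 0" for y
        using le[of y] \<rho>(2)[of "x - y"] that by (force simp: dist_norm norm_minus_commute)
    qed (use \<rho> in auto)
    ultimately show ?thesis by (simp add: dist_norm norm_minus_commute)
  qed
  show thesis
  proof (rule that[OF g0 g1 g2 cont3 sym2 sym3])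
    fix x \<delta> assume x: "cball x \<epsilon> \<subseteq> ?Q"
    show "dist (u x) (U x) \<le> \<delta>" if "\<And>y. dist x y < \<epsilon> \<Longrightarrow> dist (u x) (u y) \<le> \<delta>"
      using average[OF uQ x, of "u x" \<delta>] that by (simp add: U_def mult.commute)
    have parts: "DU x = integral ?Q (\<lambda>y. \<rho> (x - y) *\<^sub>R grad u y)"
      unfolding DU_def
      by (rule integral_convolution_gradient_by_parts[OF \<Omega> x u(1) u(3) d1 c1 \<rho>(2)])
    show "dist (grad u x) (DU x) \<le> \<delta>" if "\<And>y. dist x y < \<epsilon> \<Longrightarrow> dist (grad u x) (grad u y) \<le> \<delta>"
      unfolding parts using that
      by (intro average[OF _ x]) (auto intro: continuous_on_subset[OF u(3) \<Omega>(2)])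
    fix c
    assume le: "\<And>y. dist x y < \<epsilon> \<Longrightarrow> dist c (enn2real (source p q u y)) \<le> \<delta>"
    let ?s = "\<lambda>y. enn2real (source p q u y)"
    have cD: "continuous_on \<Omega> (\<lambda>y. D (x - y) $ i *\<^sub>R grad u y)" for i
      by (intro continuous_intros u(3) continuous_on_compose2[OF c1]) auto
    \<comment> \<open>As \<open>u\<close> is only C^1, just one of the two derivatives is moved onto
      \<open>u\<close>; the other one stays on the kernel.\<close>
    have "D2U x $ i $ i = integral ?Q (\<lambda>y. D (x - y) $ i * grad u y $ i)" for i
    proof -
      have "D2U x $ i = integral ?Q (\<lambda>y. D (x - y) $ i *\<^sub>R grad u y)"
        unfolding D2U_def vec_lambda_beta
        by (rule integral_convolution_gradient_by_parts[OF \<Omega> x u(1) u(3) d2 c2i]) (simp_all add: \<rho>(3))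
      then show ?thesis
        using integral_component_eq_cart[OF integrable_continuous[OF continuous_on_subset[OF cD \<Omega>(2)]], of i i]
        by simp
    qed
    then have "(\<Sum>i\<in>UNIV. D2U x $ i $ i) = (\<Sum>i\<in>UNIV. integral ?Q (\<lambda>y. D (x - y) $ i * grad u y $ i))"
      by simp
    also have "\<dots> = integral ?Q (\<lambda>y. \<Sum>i\<in>UNIV. D (x - y) $ i * grad u y $ i)"
      by (intro integral_sum[symmetric] integrable_continuous continuous_intros
          continuous_on_subset[OF u(3) \<Omega>(2)] continuous_on_compose2[OF c1]) auto
    also have "\<dots> = integral ?Q (\<lambda>y. grad u y \<bullet> D (x - y))"
      by (simp add: inner_vec_def mult.commute)
    also have "\<dots> = (LINT y:?Q|lborel. grad u y \<bullet> D (x - y))"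
      by (intro HK(1) continuous_intros continuous_on_subset[OF u(3) \<Omega>(2)] continuous_on_compose2[OF c1]) auto
    also have "\<dots> = (LINT y|lborel. grad u y \<bullet> D (x - y))"
      by (rule restrict[OF x]) (simp add: \<rho>(3))
    also have "\<dots> = (LINT y:\<Omega>|lborel. grad u y \<bullet> D (x - y))"
      by (rule restrict[symmetric, of x]) (use x \<Omega> in \<open>auto simp: \<rho>(3)\<close>)
    also have "\<dots> = - (LINT y:\<Omega>|lborel. grad u y \<bullet> grad (\<lambda>y. \<rho> (x - y)) y)"
    proof -
      \<comment> \<open>Differentiation in \<open>y\<close> instead of \<open>x\<close> changes the
        sign; this accounts for the minus in front of the Laplacian.\<close>
      have "grad (\<lambda>y. \<rho> (x - y)) y = - D (x - y)" for y
      proof (rule grad_eq)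
        have "((\<lambda>y. \<rho> (x - y)) has_derivative (\<lambda>h. (- h) \<bullet> D (x - y))) (at y)"
          using d1[of "x - y"] unfolding gderiv_def
          by (intro has_derivative_compose[of "\<lambda>y. x - y" "\<lambda>h. - h" _ _ \<rho>, simplified])
            (auto intro!: derivative_eq_intros)
        then show "GDERIV (\<lambda>y. \<rho> (x - y)) y :> - D (x - y)" by (simp add: gderiv_def)
      qed
      then show ?thesis by (simp add: set_lebesgue_integral_def)
    qed
    also have "(LINT y:\<Omega>|lborel. grad u y \<bullet> grad (\<lambda>y. \<rho> (x - y)) y) = (LINT y:\<Omega>|lborel. ?s y * \<rho> (x - y))"
      using sol \<rho>(6)[of x \<Omega>] x \<Omega> unfolding positive_weak_solution_def by blast
    also have "\<dots> = (LINT y|lborel. ?s y * \<rho> (x - y))"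
      by (rule restrict[of x]) (use x \<Omega> in \<open>auto simp: \<rho>(2)\<close>)
    finally have lap: "- (\<Sum>i\<in>UNIV. D2U x $ i $ i) = (LINT y|lborel. \<rho> (x - y) *\<^sub>R ?s y)"
      by (simp add: mult.commute)
    have "norm ((LINT y|lborel. \<rho> (x - y) *\<^sub>R ?s y) - c) \<le> \<delta>"
    proof (rule norm_average_diff_le)
      \<comment> \<open>\<open>L1_loc\<close> gives measurability after cutting off to a compact
        set; multiplied by the kernel, the source is not changed by the cutoff.\<close>
      have "(\<lambda>y. source p q u y * indicator (cball x \<epsilon>) y) \<in> borel_measurable lborel"
        using sol x \<Omega> unfolding positive_weak_solution_def L1_loc_def by (meson compact_cball order_trans)
      then have "(\<lambda>y. \<rho> (x - y) *\<^sub>R enn2real (source p q u y * indicator (cball x \<epsilon>) y)) \<in> borel_measurable lborel"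
        by (intro borel_measurable_scaleR borel_measurable_integrable[OF \<rho>(4)] borel_measurable_enn2real)
      moreover have "\<rho> (x - y) *\<^sub>R enn2real (source p q u y * indicator (cball x \<epsilon>) y) = \<rho> (x - y) *\<^sub>R ?s y" for y
        using \<rho>(2)[of "x - y"] by (cases "y \<in> cball x \<epsilon>") (auto simp: dist_norm indicator_def)
      ultimately show "(\<lambda>y. \<rho> (x - y) *\<^sub>R ?s y) \<in> borel_measurable lborel" by (simp only:)
      show "norm (?s y - c) \<le> \<delta>" if "\<rho> (x - y) \<noteq> 0" for y
        using le[of y] \<rho>(2)[of "x - y"] that by (force simp: dist_norm norm_minus_commute)
    qed (use \<rho> in auto)
    then show "dist c (- (\<Sum>i\<in>UNIV. D2U x $ i $ i)) \<le> \<delta>"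
      unfolding lap by (simp add: dist_norm norm_minus_commute)
  qed
qed

section \<open>The pointwise inequality\<close>

text \<open>The left side is the squared trace of \<open>W\<close> over the orthogonal complement of
  \<open>V\<close>. It is the Frobenius product of \<open>W\<close> with the orthogonal projection
  \<open>P\<close> onto that complement, whose squared norm is its dimension N - 1, so
  Cauchy-Schwarz applies. Splitting off the direction \<open>V\<close> is what puts N - 1 in place
  of N into the exponent condition.\<close>

lemma trace_minus_direction_le:
  fixes W :: "real^'n^'n" and V :: "real^'n"
  assumes "V \<noteq> 0"
  shows "((\<Sum>i\<in>UNIV. W $ i $ i) - (V \<bullet> (W *v V)) / (V \<bullet> V))\<^sup>2 \<le> (real CARD('n) - 1) * (W \<bullet> W)"
proof -
  let ?H = "V \<bullet> V"
  define P :: "real^'n^'n" where "P = (\<chi> i j. (if i = j then 1 else 0) - V $ i * V $ j / ?H)"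
  have H: "?H > 0" using assms by simp
  have HV: "(\<Sum>i\<in>UNIV. V $ i * V $ i) = ?H" by (simp add: inner_vec_def)
  have WP: "W \<bullet> P = (\<Sum>i\<in>UNIV. W $ i $ i) - (V \<bullet> (W *v V)) / ?H"
  proof -
    have "W \<bullet> P = (\<Sum>i\<in>UNIV. \<Sum>j\<in>UNIV. W $ i $ j * (if i = j then 1 else 0) - W $ i $ j * (V $ i * V $ j / ?H))"
      by (simp add: inner_vec_def P_def algebra_simps)
    also have "\<dots> = (\<Sum>i\<in>UNIV. W $ i $ i) - (\<Sum>i\<in>UNIV. \<Sum>j\<in>UNIV. W $ i $ j * (V $ i * V $ j / ?H))"
      by (simp add: sum_subtractf if_distrib[of "(*) _"] cong: if_cong)
    also have "(\<Sum>i\<in>UNIV. \<Sum>j\<in>UNIV. W $ i $ j * (V $ i * V $ j / ?H)) = (V \<bullet> (W *v V)) / ?H"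
      by (simp add: inner_vec_def matrix_vector_mult_def sum_distrib_left sum_divide_distrib mult_ac)
    finally show ?thesis .
  qed
  have PP: "P \<bullet> P = real CARD('n) - 1"
  proof -
    have "P \<bullet> P = (\<Sum>i\<in>UNIV. \<Sum>j\<in>UNIV. (if i = j then 1 - 2 * (V $ i * V $ i / ?H) else 0)
        + V $ i * V $ i * (V $ j * V $ j) / ?H\<^sup>2)"
      unfolding inner_vec_def P_def
      by (intro sum.cong refl) (auto simp: algebra_simps power2_eq_square)
    also have "\<dots> = (\<Sum>i\<in>UNIV. 1 - 2 * (V $ i * V $ i / ?H))
        + (\<Sum>i\<in>UNIV. \<Sum>j\<in>UNIV. V $ i * V $ i * (V $ j * V $ j) / ?H\<^sup>2)"
      by (simp add: sum.distrib)
    also have "(\<Sum>i\<in>UNIV. 1 - 2 * (V $ i * V $ i / ?H)) = real CARD('n) - 2 * ((\<Sum>i\<in>UNIV. V $ i * V $ i) / ?H)"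
      by (simp add: sum_subtractf sum_distrib_left sum_divide_distrib)
    also have "(\<Sum>i\<in>UNIV. \<Sum>j\<in>UNIV. V $ i * V $ i * (V $ j * V $ j) / ?H\<^sup>2)
        = (\<Sum>i\<in>UNIV. V $ i * V $ i) * (\<Sum>j\<in>UNIV. V $ j * V $ j) / ?H\<^sup>2"
      by (simp add: sum_product sum_divide_distrib)
    finally show ?thesis using H by (simp add: HV power2_eq_square)
  qed
  have "(W \<bullet> P)\<^sup>2 \<le> (W \<bullet> W) * (P \<bullet> P)" by (rule Cauchy_Schwarz_ineq)
  then show ?thesis by (simp add: WP PP mult.commute)
qed

lemma mult_le_square_plus:
  fixes x y k :: real
  assumes "k > 0"
  shows "x * y \<le> k * x\<^sup>2 + y\<^sup>2 / (4 * k)"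
proof -
  have "0 \<le> (2 * k * x - y)\<^sup>2 / (4 * k)" using assms by simp
  also have "\<dots> = k * x\<^sup>2 + y\<^sup>2 / (4 * k) - x * y"
    using assms by (simp add: field_simps power2_eq_square)
  finally show ?thesis by simp
qed

text \<open>To be used with \<nu> = N - 1 and a = p + q - 1. At F = H and s = 0 the form equals
  (4/\<nu> - a) H^2, so the bound on \<open>a\<close> is sharp. The terms mixed with
  \<open>s\<close> are absorbed by Young's inequality, keeping half of the H^2 part.\<close>

lemma subcritical_quadratic_form:
  fixes \<nu> a q :: real
  assumes "\<nu> > 0" "a < 4 / \<nu>"
  obtains c C where "c > 0" "C \<ge> 0"
    "\<And>F H s. F \<ge> 0 \<Longrightarrow> H \<ge> 0 \<Longrightarrow>
      c * H\<^sup>2 - C * s\<^sup>2 \<le> (F + H + s)\<^sup>2 / \<nu> - a * F * H - (q * F + 2 * H) * s"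
proof -
  \<comment> \<open>From F H \<le> (F + H)^2/4. For negative \<open>a\<close> the term - a F H is
    nonnegative and is dropped, hence \<open>max a 0\<close>.\<close>
  define k where "k = 1 / \<nu> - max a 0 / 4"
  have k: "k > 0" using assms by (auto simp: k_def max_def)
  define L where "L = 2 / \<nu> + \<bar>q\<bar> + 2"
  have L: "L \<ge> 0" using assms by (simp add: L_def)
  have main: "k / 2 * H\<^sup>2 - L\<^sup>2 / k * s\<^sup>2 \<le> (F + H + s)\<^sup>2 / \<nu> - a * F * H - (q * F + 2 * H) * s"
    if F: "F \<ge> 0" and H: "H \<ge> 0" for F H s
  proof -
    have "a * F * H \<le> max a 0 * (F * H)" using F H by (simp add: mult.assoc mult_right_mono)
    also have "\<dots> \<le> max a 0 * ((F + H)\<^sup>2 / 4)"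
    proof (rule mult_left_mono)
      have "0 \<le> (F - H)\<^sup>2" by simp
      then show "F * H \<le> (F + H)\<^sup>2 / 4" by (simp add: power2_eq_square algebra_simps)
    qed simp
    finally have "(F + H)\<^sup>2 / \<nu> - a * F * H \<ge> k * (F + H)\<^sup>2" by (simp add: k_def algebra_simps)
    moreover have "k * (F + H)\<^sup>2 \<ge> k * (F\<^sup>2 + H\<^sup>2)"
      using k F H by (intro mult_left_mono) (auto simp: power2_eq_square algebra_simps)
    ultimately have 1: "(F + H)\<^sup>2 / \<nu> - a * F * H \<ge> k * F\<^sup>2 + k * H\<^sup>2" by (simp add: algebra_simps)
    have "\<bar>2 * (F + H) / \<nu> - q * F - 2 * H\<bar> \<le> \<bar>2 * (F + H) / \<nu>\<bar> + \<bar>q * F\<bar> + \<bar>2 * H\<bar>" by linarith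
    also have "\<dots> = 2 / \<nu> * (F + H) + \<bar>q\<bar> * F + 2 * H" using F H assms less_imp_le[OF assms(1)] by (simp add: abs_mult)
    also have "\<dots> \<le> 2 / \<nu> * (F + H) + \<bar>q\<bar> * (F + H) + 2 * (F + H)"
      using F H less_imp_le[OF assms(1)] by (intro add_mono mult_left_mono) auto
    also have "\<dots> = L * (F + H)" by (simp add: L_def algebra_simps)
    finally have "\<bar>(2 * (F + H) / \<nu> - q * F - 2 * H) * s\<bar> \<le> L * (F + H) * \<bar>s\<bar>"
      unfolding abs_mult by (rule mult_right_mono) simp
    moreover have "F * (L * \<bar>s\<bar>) \<le> k * F\<^sup>2 + (L * \<bar>s\<bar>)\<^sup>2 / (4 * k)"
      using k by (rule mult_le_square_plus)
    moreover have "H * (L * \<bar>s\<bar>) \<le> k / 2 * H\<^sup>2 + (L * \<bar>s\<bar>)\<^sup>2 / (4 * (k / 2))"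
      using k by (intro mult_le_square_plus) simp
    ultimately have 2: "(2 * (F + H) / \<nu> - q * F - 2 * H) * s
        \<ge> - (k * F\<^sup>2 + k / 2 * H\<^sup>2 + (L * \<bar>s\<bar>)\<^sup>2 / (4 * k) + (L * \<bar>s\<bar>)\<^sup>2 / (4 * (k / 2)))"
      by (simp add: algebra_simps)
    have 3: "(L * \<bar>s\<bar>)\<^sup>2 / (4 * k) + (L * \<bar>s\<bar>)\<^sup>2 / (4 * (k / 2)) \<le> L\<^sup>2 / k * s\<^sup>2"
      using k by (simp add: power_mult_distrib field_simps)
    have 4: "(F + H + s)\<^sup>2 / \<nu> - a * F * H - (q * F + 2 * H) * s =
      ((F + H)\<^sup>2 / \<nu> - a * F * H) + (2 * (F + H) / \<nu> - q * F - 2 * H) * s + s\<^sup>2 / \<nu>"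
      using assms by (simp add: power2_eq_square field_simps)
    have 5: "s\<^sup>2 / \<nu> \<ge> 0" using assms by simp
    show ?thesis using 1 2 3 5 unfolding 4 by linarith
  qed
  show thesis by (rule that[of "k / 2" "L\<^sup>2 / k"]) (use k main in auto)
qed

text \<open>\<open>s\<close> is the value of \<open>\<sigma>\<close> at points where
  \<open>gG\<close> vanishes, because (V \<bullet> gG)/(2 H) = E (\<sigma> - s); replacing
  \<open>\<sigma>\<close> by \<open>s\<close> costs terms linear in \<open>gG\<close>. The constant
  4 C comes from E s^2 = 4 (V \<bullet> z)^2 \<le> 4 H R^2, where the second order vanishing of the
  cutoff cancels the denominator of \<open>s\<close>. The constants 12 and 2 N come from the cutoff
  terms: once \<open>gH\<close> is expressed by \<open>gG\<close>, they leave (- 16 + 4) H |z|^2 - 2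
  N H \<eta>.\<close>

lemma bernstein_pointwise_identity:
  fixes V z gE gH gG :: "real^'n" and W :: "real^'n^'n"
  assumes form: "\<And>F H s. F \<ge> 0 \<Longrightarrow> H \<ge> 0 \<Longrightarrow>
      c * H\<^sup>2 - C * s\<^sup>2 \<le> (F + H + s)\<^sup>2 / \<nu> - a * F * H - (q * F + 2 * H) * s"
    and C: "C \<ge> 0" and \<nu>: "\<nu> = real CARD('n) - 1" "\<nu> \<ge> 1"
    and \<eta>: "\<eta> > 0" "\<eta> \<le> R\<^sup>2" "z \<bullet> z \<le> R\<^sup>2" and E: "E = \<eta>\<^sup>2" "gE = (- 4 * \<eta>) *\<^sub>R z"
    and lapE: "lapE = 8 * (z \<bullet> z) - 4 * real CARD('n) * \<eta>"
    and H: "H = V \<bullet> V" "H > 0" and F: "F \<ge> 0"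
    and tr: "(\<Sum>i\<in>UNIV. W $ i $ i) = - F - H - r"
    and gH: "V \<bullet> gH = 2 * (V \<bullet> (W *v V))" and gG: "gG = E *\<^sub>R gH + H *\<^sub>R gE"
    and \<sigma>: "\<sigma> = (V \<bullet> gH) / (2 * H)" and s: "s = 2 * (V \<bullet> z) / \<eta>"
  shows "H * (c * (E * H) - (4 * C + 12 + 2 * real CARD('n)) * R\<^sup>2)
      + (V \<bullet> gG) / (2 * H) * (2 * (F + H + s) / \<nu> - q * F - 2 * H)
      + 2 * E * (F + H + s) * r / \<nu> - 4 * (z \<bullet> gG) / \<eta>
    \<le> E * (W \<bullet> W - (a * F * H + (q * F + 2 * H) * \<sigma>)) + gE \<bullet> gH + H * lapE / 2"
proof -
  define t where "t = \<sigma> - s"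
  have V: "V \<noteq> 0" using H by auto
  have Epos: "E > 0" using \<eta> E by simp
  have \<sigma>W: "(V \<bullet> (W *v V)) / (V \<bullet> V) = \<sigma>" using gH H \<sigma> by simp
  \<comment> \<open>Up to sign, trace minus \<open>\<sigma>\<close> is F + H + s plus the
    perturbation r + t, whose square is then discarded.\<close>
  have "(F + H + s + (r + t))\<^sup>2 = ((\<Sum>i\<in>UNIV. W $ i $ i) - \<sigma>)\<^sup>2"
    unfolding tr t_def by (simp add: power2_eq_square algebra_simps)
  also have "\<dots> \<le> \<nu> * (W \<bullet> W)"
    using trace_minus_direction_le[OF V, of W] \<sigma>W \<nu> by simp
  finally have "(F + H + s)\<^sup>2 + 2 * (F + H + s) * (r + t) \<le> \<nu> * (W \<bullet> W)"
    using zero_le_power2[of "r + t"] unfolding power2_sum[of "F + H + s"] by linarith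
  then have WW: "(F + H + s)\<^sup>2 / \<nu> + 2 * (F + H + s) * (r + t) / \<nu> \<le> W \<bullet> W"
    using \<nu> by (simp add: add_divide_distrib[symmetric] divide_le_eq mult.commute)
  have VgG: "V \<bullet> gG = E * (2 * H * \<sigma>) - 4 * \<eta> * H * (V \<bullet> z)"
    using H \<sigma> unfolding gG E(2) by (simp add: inner_add_right inner_diff_right mult_ac)
  have Et: "(V \<bullet> gG) / (2 * H) = E * t"
    unfolding VgG t_def s E(1) using H \<eta> by (simp add: field_simps power2_eq_square)
  have zgH: "z \<bullet> gH = (z \<bullet> gG + 4 * H * \<eta> * (z \<bullet> z)) / E"
    unfolding gG E(2) using Epos by (simp add: inner_add_right inner_diff_right field_simps)
  have gEgH: "gE \<bullet> gH = - 4 * (z \<bullet> gG) / \<eta> - 16 * H * (z \<bullet> z)"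
    unfolding E(2) inner_scaleR_left zgH unfolding E(1) using \<eta>
    by (simp add: field_simps power2_eq_square)
  have main: "E * (c * H\<^sup>2 - C * s\<^sup>2) \<le> E * ((F + H + s)\<^sup>2 / \<nu> - a * F * H - (q * F + 2 * H) * s)"
    using form[OF F less_imp_le[OF H(2)]] Epos by (intro mult_left_mono) auto
  have "E * s\<^sup>2 = 4 * (V \<bullet> z)\<^sup>2" unfolding E(1) s using \<eta> by (simp add: power2_eq_square)
  also have "\<dots> \<le> 4 * (H * (z \<bullet> z))" using Cauchy_Schwarz_ineq[of V z] H by simp
  also have "\<dots> \<le> 4 * (H * R\<^sup>2)" using H \<eta> by (intro mult_left_mono) auto
  finally have Es: "C * (E * s\<^sup>2) \<le> C * (4 * (H * R\<^sup>2))" using C by (rule mult_left_mono)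
  have zz: "12 * H * (z \<bullet> z) \<le> 12 * H * R\<^sup>2" using H \<eta> by (intro mult_left_mono) auto
  have NN: "2 * real CARD('n) * H * \<eta> \<le> 2 * real CARD('n) * H * R\<^sup>2"
    using H \<eta> by (intro mult_left_mono) auto
  have WW': "E * ((F + H + s)\<^sup>2 / \<nu> + 2 * (F + H + s) * (r + t) / \<nu>) \<le> E * (W \<bullet> W)"
    using WW Epos by (intro mult_left_mono) auto
  have id: "E * (W \<bullet> W - (a * F * H + (q * F + 2 * H) * \<sigma>)) + gE \<bullet> gH + H * lapE / 2
    = E * (W \<bullet> W) - E * ((F + H + s)\<^sup>2 / \<nu> + 2 * (F + H + s) * (r + t) / \<nu>)
      + E * ((F + H + s)\<^sup>2 / \<nu> - a * F * H - (q * F + 2 * H) * s)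
      + E * t * (2 * (F + H + s) / \<nu> - q * F - 2 * H) + 2 * E * (F + H + s) * r / \<nu>
      - 4 * (z \<bullet> gG) / \<eta> - 12 * H * (z \<bullet> z) - 2 * real CARD('n) * H * \<eta>"
  proof -
    have "\<sigma> = s + t" by (simp add: t_def)
    then show ?thesis unfolding gEgH lapE using \<nu>(2) by (simp add: field_simps)
  qed
  have "H * (c * (E * H) - (4 * C + 12 + 2 * real CARD('n)) * R\<^sup>2)
      = E * (c * H\<^sup>2) - C * (4 * (H * R\<^sup>2)) - 12 * H * R\<^sup>2 - 2 * real CARD('n) * H * R\<^sup>2"
    by (simp add: algebra_simps power2_eq_square)
  moreover have "E * (c * H\<^sup>2 - C * s\<^sup>2) = E * (c * H\<^sup>2) - C * (E * s\<^sup>2)" by (simp add: algebra_simps)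
  ultimately have lower: "H * (c * (E * H) - (4 * C + 12 + 2 * real CARD('n)) * R\<^sup>2)
      \<le> E * ((F + H + s)\<^sup>2 / \<nu> - a * F * H - (q * F + 2 * H) * s)
        - 12 * H * (z \<bullet> z) - 2 * real CARD('n) * H * \<eta>"
    using main Es zz NN by (simp only:)
  have arith: "l + t' + r' - g' \<le> w - w' + m + t' + r' - g' - x - y"
    if "l \<le> m - x - y" "w' \<le> w" for l t' r' g' w w' m x y :: real using that by linarith
  show ?thesis unfolding id Et by (rule arith[OF lower WW'])
qed

text \<open>Every term is linear in \<open>gG\<close> or in \<open>r\<close>. \<open>B\<close> is
  built from bounds alone, which allows the exponent to be chosen before the mollification. The
  bound \<open>h1 + 1\<close> for |V| follows from 2 |V| \<le> |V|^2 + 1.\<close>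

lemma bernstein_pointwise_error:
  fixes V z gG :: "real^'n"
  assumes "\<nu> \<ge> (1::real)" "0 < h0" "h0 \<le> H" "H \<le> h1" "H = V \<bullet> V" "0 \<le> F" "F \<le> f1"
    "0 < \<eta>0" "\<eta>0 \<le> \<eta>" "\<eta> \<le> R\<^sup>2" "z \<bullet> z \<le> R\<^sup>2" "R > 0" "E = \<eta>\<^sup>2" "s = 2 * (V \<bullet> z) / \<eta>"
    and s1: "s1 = 2 * (h1 + 1) * R / \<eta>0" and m: "m = f1 + h1 + s1"
    and B: "B = (h1 + 1) / (2 * h0) * (2 * m + \<bar>q\<bar> * f1 + 2 * h1) + 4 * R / \<eta>0 + 2 * R ^ 4 * m"
  shows "- (B * norm gG) - B * \<bar>r\<bar>
    \<le> (V \<bullet> gG) / (2 * H) * (2 * (F + H + s) / \<nu> - q * F - 2 * H)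
      + 2 * E * (F + H + s) * r / \<nu> - 4 * (z \<bullet> gG) / \<eta>"
proof -
  have pos: "0 \<le> h1" "0 \<le> f1" "0 < H" "0 < \<eta>" using assms by linarith+
  have nz: "norm z \<le> R" using assms by (simp add: norm_le_square)
  have nV: "norm V \<le> h1 + 1"
  proof -
    have "(norm V)\<^sup>2 \<le> h1" using assms by (simp add: dot_square_norm)
    moreover have "0 \<le> (norm V - 1)\<^sup>2" by simp
    then have "2 * norm V \<le> (norm V)\<^sup>2 + 1" by (simp add: power2_eq_square algebra_simps)
    ultimately show ?thesis using pos by linarith
  qed
  have "\<bar>V \<bullet> z\<bar> \<le> (h1 + 1) * R"
    using Cauchy_Schwarz_ineq2[of V z] mult_mono[OF nV nz] pos by fastforce
  then have "\<bar>s\<bar> \<le> 2 * ((h1 + 1) * R) / \<eta>"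
    unfolding assms(14) using pos by (simp add: abs_mult divide_right_mono)
  also have "\<dots> \<le> 2 * ((h1 + 1) * R) / \<eta>0"
    using assms pos by (intro divide_left_mono) auto
  finally have s: "\<bar>s\<bar> \<le> s1" by (simp only: s1 mult.assoc)
  then have FHs: "\<bar>F + H + s\<bar> \<le> m" using assms(3-7) pos unfolding m by linarith
  have m0: "m \<ge> 0" using FHs by linarith
  have d\<nu>: "\<bar>x / \<nu>\<bar> \<le> \<bar>x\<bar>" for x
    using assms(1) by (simp add: divide_le_eq) (metis abs_ge_zero mult_le_cancel_left1 mult.commute not_less)
  have A: "\<bar>2 * (F + H + s) / \<nu> - q * F - 2 * H\<bar> \<le> 2 * m + \<bar>q\<bar> * f1 + 2 * h1"
  proof -
    have "\<bar>2 * (F + H + s) / \<nu>\<bar> \<le> 2 * m" using d\<nu>[of "2 * (F + H + s)"] FHs by simp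
    moreover have "\<bar>q * F\<bar> \<le> \<bar>q\<bar> * f1" using assms by (simp add: abs_mult mult_left_mono)
    ultimately show ?thesis using assms pos by linarith
  qed
  have "\<bar>(V \<bullet> gG) / (2 * H)\<bar> \<le> (h1 + 1) * norm gG / (2 * H)"
  proof -
    have "\<bar>V \<bullet> gG\<bar> \<le> (h1 + 1) * norm gG"
      using Cauchy_Schwarz_ineq2[of V gG] mult_right_mono[OF nV norm_ge_zero[of gG]] by linarith
    then show ?thesis using pos by (simp add: divide_right_mono)
  qed
  also have "\<dots> \<le> (h1 + 1) * norm gG / (2 * h0)"
    using assms pos by (intro divide_left_mono) auto
  finally have T: "\<bar>(V \<bullet> gG) / (2 * H)\<bar> \<le> (h1 + 1) * norm gG / (2 * h0)" .
  have "\<bar>(V \<bullet> gG) / (2 * H) * (2 * (F + H + s) / \<nu> - q * F - 2 * H)\<bar>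
      \<le> (h1 + 1) * norm gG / (2 * h0) * (2 * m + \<bar>q\<bar> * f1 + 2 * h1)"
    unfolding abs_mult using assms pos by (intro mult_mono T A) auto
  then have 1: "\<bar>(V \<bullet> gG) / (2 * H) * (2 * (F + H + s) / \<nu> - q * F - 2 * H)\<bar>
      \<le> (h1 + 1) / (2 * h0) * (2 * m + \<bar>q\<bar> * f1 + 2 * h1) * norm gG" by (simp add: mult_ac)
  have "\<bar>z \<bullet> gG\<bar> \<le> R * norm gG"
    using Cauchy_Schwarz_ineq2[of z gG] mult_right_mono[OF nz norm_ge_zero[of gG]] by linarith
  then have "\<bar>4 * (z \<bullet> gG) / \<eta>\<bar> \<le> 4 * (R * norm gG) / \<eta>"
    using pos by (simp add: abs_mult divide_right_mono)
  also have "\<dots> \<le> 4 * (R * norm gG) / \<eta>0" using assms pos by (intro divide_left_mono) auto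
  finally have 2: "\<bar>4 * (z \<bullet> gG) / \<eta>\<bar> \<le> 4 * R / \<eta>0 * norm gG" by (simp add: mult_ac)
  have E: "0 \<le> E" "E \<le> R ^ 4"
  proof -
    have "\<eta>\<^sup>2 \<le> (R\<^sup>2)\<^sup>2" using assms pos by (intro power_mono) auto
    then show "E \<le> R ^ 4" using assms by simp
  qed (use assms in simp)
  have "\<bar>2 * E * (F + H + s) * r / \<nu>\<bar> \<le> \<bar>2 * E * (F + H + s) * r\<bar>" by (rule d\<nu>)
  also have "\<dots> = 2 * (E * \<bar>F + H + s\<bar>) * \<bar>r\<bar>" using E by (simp add: abs_mult)
  also have "\<dots> \<le> 2 * (R ^ 4 * m) * \<bar>r\<bar>"
    using E FHs by (intro mult_right_mono mult_left_mono mult_mono) auto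
  finally have 3: "\<bar>2 * E * (F + H + s) * r / \<nu>\<bar> \<le> 2 * R ^ 4 * m * \<bar>r\<bar>" by simp
  let ?b1 = "(h1 + 1) / (2 * h0) * (2 * m + \<bar>q\<bar> * f1 + 2 * h1)" and ?b2 = "4 * R / \<eta>0" and ?b3 = "2 * R ^ 4 * m"
  have b: "?b1 \<ge> 0" "?b2 \<ge> 0" "?b3 \<ge> 0" using assms pos m0 by simp_all
  have "?b1 * norm gG + ?b2 * norm gG \<le> B * norm gG"
    unfolding distrib_right[symmetric] B using b by (intro mult_right_mono) auto
  moreover have "?b3 * \<bar>r\<bar> \<le> B * \<bar>r\<bar>" unfolding B using b by (intro mult_right_mono) auto
  moreover have arith: "- x - y \<le> a + b - c" if "p' + q' \<le> x" "r' \<le> y" "\<bar>a\<bar> \<le> p'" "\<bar>c\<bar> \<le> q'" "\<bar>b\<bar> \<le> r'"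
    for a b c x y p' q' r' :: real using that by linarith
  ultimately show ?thesis using 1 2 3 by (intro arith)
qed

section \<open>The divergence identity\<close>

text \<open>An exponent of at least 2 makes the truncated power continuously differentiable, so that
  it may multiply a vector field under the divergence.\<close>

lemma DERIV_pos_part_power:
  "DERIV (\<lambda>t::real. max 0 t ^ (n + 2)) t :> real (n + 2) * max 0 t ^ (n + 1)"
proof -
  consider "t > 0" | "t < 0" | "t = 0" by linarith
  then show ?thesis
  proof cases
    case 1
    have "DERIV (\<lambda>t. t ^ (n + 2)) t :> real (n + 2) * max 0 t ^ (n + 1)"
      using 1 DERIV_pow[of "n + 2" t] by simp
    then show ?thesis
      by (rule has_field_derivative_transform_within_open[of _ _ _ "{0<..}"]) (use 1 in auto)
  next
    case 2
    have "DERIV (\<lambda>_. 0) t :> real (n + 2) * max 0 t ^ (n + 1)" using 2 by simp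
    then show ?thesis
      by (rule has_field_derivative_transform_within_open[of _ _ _ "{..<0}"]) (use 2 in auto)
  next
    case 3
    have "((\<lambda>h::real. max 0 h ^ (n + 2) / h) \<longlongrightarrow> 0) (at 0)"
    proof (rule Lim_null_comparison)
      have "norm (max 0 h ^ (n + 2) / h) \<le> \<bar>h\<bar> ^ (n + 1)" for h :: real
        using zero_le_power[of "\<bar>h\<bar>" "n + 1"] by (cases "h > 0") auto
      then show "\<forall>\<^sub>F h in at 0. norm (max 0 h ^ (n + 2) / h) \<le> \<bar>h\<bar> ^ (n + 1)"
        by (intro always_eventually) blast
      have "((\<lambda>h::real. \<bar>h\<bar> ^ (n + 1)) \<longlongrightarrow> \<bar>0\<bar> ^ (n + 1)) (at 0)" by (intro tendsto_intros)
      then show "((\<lambda>h::real. \<bar>h\<bar> ^ (n + 1)) \<longlongrightarrow> 0) (at 0)" by simp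
    qed
    then show ?thesis using 3 by (simp add: DERIV_def)
  qed
qed

lemma GDERIV_sum:
  "(\<And>i. i \<in> I \<Longrightarrow> GDERIV (f i) x :> D i) \<Longrightarrow> GDERIV (\<lambda>x. \<Sum>i\<in>I. f i x) x :> (\<Sum>i\<in>I. D i)"
  unfolding gderiv_def inner_sum_right by (rule has_derivative_sum)

locale log_gradient =
  fixes U :: "real^'n \<Rightarrow> real" and V :: "real^'n \<Rightarrow> real^'n" and W T
    and S :: "(real^'n) set" and x0 :: "real^'n" and R a q :: real
  assumes open_S: "open S"
    and U_pos: "\<And>x. x \<in> S \<Longrightarrow> U x > 0" and V_nz: "\<And>x. x \<in> S \<Longrightarrow> V x \<noteq> 0"
    and U_deriv: "\<And>x. x \<in> S \<Longrightarrow> GDERIV U x :> U x *\<^sub>R V x"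
    and V_deriv: "\<And>x i. x \<in> S \<Longrightarrow> GDERIV (\<lambda>x. V x $ i) x :> W x $ i"
    and W_deriv: "\<And>x i j. x \<in> S \<Longrightarrow> GDERIV (\<lambda>x. W x $ i $ j) x :> T x $ i $ j"
    and T_cont: "continuous_on S T"
    and W_sym: "\<And>x i j. x \<in> S \<Longrightarrow> W x $ i $ j = W x $ j $ i"
    and T_sym: "\<And>x i j k. x \<in> S \<Longrightarrow> T x $ i $ j $ k = T x $ j $ i $ k"
      "\<And>x i j k. x \<in> S \<Longrightarrow> T x $ i $ j $ k = T x $ i $ k $ j"
begin

definition "\<eta> x = R\<^sup>2 - (x - x0) \<bullet> (x - x0)"
definition "E x = (\<eta> x)\<^sup>2"
definition "gE x = (- 4 * \<eta> x) *\<^sub>R (x - x0)"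
definition "lapE x = 8 * ((x - x0) \<bullet> (x - x0)) - 4 * real CARD('n) * \<eta> x"
definition "H x = V x \<bullet> V x"
definition "gH x = 2 *\<^sub>R (V x v* W x)"
definition "G x = E x * H x"
definition "gG x = E x *\<^sub>R gH x + H x *\<^sub>R gE x"
text \<open>With a = p + q - 1 this is U^(p-1) |grad U|^q, by |grad U| = U |V|.\<close>

definition "F x = U x powr a * H x powr (q / 2)"
definition "gF x = F x *\<^sub>R (a *\<^sub>R V x + (q / (2 * H x)) *\<^sub>R gH x)"
definition "tr x = (\<Sum>i\<in>UNIV. W x $ i $ i)"
text \<open>As \<open>tr\<close> is the Laplacian of \<open>U\<close> over \<open>U\<close> minus
  \<open>H\<close>, this is the defect in the equation divided by \<open>U\<close>.\<close>

definition "r x = - tr x - F x - H x"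
definition "gr x = - (\<Sum>i\<in>UNIV. T x $ i $ i) - gF x - gH x"
text \<open>The gradient of the j-th component of \<open>gH\<close>; likewise \<open>EE\<close> for
  \<open>gE\<close> and \<open>DX\<close> for \<open>X\<close>.\<close>

definition "HH x j = 2 *\<^sub>R (\<Sum>i\<in>UNIV. V x $ i *\<^sub>R T x $ i $ j + W x $ i $ j *\<^sub>R W x $ i)"
definition "EE x j = (- 4 * \<eta> x) *\<^sub>R axis j 1 + (x - x0) $ j *\<^sub>R (8 *\<^sub>R (x - x0))"
text \<open>Bochner's formula puts - E (V \<bullet> gr) into the divergence of the first summand;
  the correction \<open>E r V\<close> contributes the same term with the opposite sign, at the price
  of terms containing \<open>r\<close> itself.\<close>

definition "X x j = gG x $ j / 2 + (E x * r x) * V x $ j"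
definition "DX x j = (1 / 2) *\<^sub>R ((E x *\<^sub>R HH x j + gH x $ j *\<^sub>R gE x) + (H x *\<^sub>R EE x j + gE x $ j *\<^sub>R gH x))
   + ((E x * r x) *\<^sub>R W x $ j + V x $ j *\<^sub>R (E x *\<^sub>R gr x + r x *\<^sub>R gE x))"

lemma gH_component: "gH x $ j = 2 * (\<Sum>i\<in>UNIV. V x $ i * W x $ i $ j)"
  by (simp add: gH_def vector_matrix_mult_def mult.commute)

lemma H_pos: "x \<in> S \<Longrightarrow> H x > 0"
  using V_nz by (simp add: H_def)

lemma GDERIV_\<eta>: "GDERIV \<eta> x :> (-2) *\<^sub>R (x - x0)"
  using GDERIV_diff[OF GDERIV_const GDERIV_dot_self[of x0]] by (simp add: \<eta>_def[abs_def])

lemma GDERIV_E: "GDERIV E x :> gE x"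
proof -
  have "GDERIV (\<lambda>x. \<eta> x * \<eta> x) x :> gE x"
    by (rule GDERIV_subst[OF GDERIV_mult[OF GDERIV_\<eta> GDERIV_\<eta>]]) (simp add: gE_def vec_eq_iff right_diff_distrib)
  then show ?thesis by (simp add: E_def[abs_def] power2_eq_square)
qed

lemma GDERIV_gE: "GDERIV (\<lambda>x. gE x $ j) x :> EE x j"
proof -
  have "GDERIV (\<lambda>x. (- 4 * \<eta> x) * (x $ j - x0 $ j)) x :>
    (- 4 * \<eta> x) *\<^sub>R (axis j 1 - 0) + (x $ j - x0 $ j) *\<^sub>R ((- 4) *\<^sub>R ((-2) *\<^sub>R (x - x0)) + \<eta> x *\<^sub>R 0)"
    by (intro GDERIV_mult GDERIV_diff GDERIV_component GDERIV_const GDERIV_\<eta>)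
  then show ?thesis unfolding gE_def vector_scaleR_component vector_minus_component real_scaleR_def EE_def
    by (rule GDERIV_subst) simp
qed

lemma GDERIV_H: "x \<in> S \<Longrightarrow> GDERIV H x :> gH x"
proof -
  assume x: "x \<in> S"
  have "GDERIV (\<lambda>x. \<Sum>i\<in>UNIV. V x $ i * V x $ i) x :> (\<Sum>i\<in>UNIV. V x $ i *\<^sub>R W x $ i + V x $ i *\<^sub>R W x $ i)"
    by (intro GDERIV_sum GDERIV_mult V_deriv x)
  moreover have "(\<lambda>x. \<Sum>i\<in>UNIV. V x $ i * V x $ i) = H" by (simp add: H_def inner_vec_def fun_eq_iff)
  moreover have "(\<Sum>i\<in>UNIV. V x $ i *\<^sub>R W x $ i + V x $ i *\<^sub>R W x $ i) = gH x"
    by (simp add: vec_eq_iff gH_component sum.distrib sum_distrib_left mult.left_commute)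
  ultimately show ?thesis by simp
qed

lemma GDERIV_gH: "x \<in> S \<Longrightarrow> GDERIV (\<lambda>x. gH x $ j) x :> HH x j"
proof -
  assume x: "x \<in> S"
  have "GDERIV (\<lambda>x. 2 * (\<Sum>i\<in>UNIV. V x $ i * W x $ i $ j)) x :>
      2 *\<^sub>R (\<Sum>i\<in>UNIV. V x $ i *\<^sub>R T x $ i $ j + W x $ i $ j *\<^sub>R W x $ i) + (\<Sum>i\<in>UNIV. V x $ i * W x $ i $ j) *\<^sub>R 0"
    by (intro GDERIV_mult GDERIV_sum GDERIV_const V_deriv W_deriv x)
  then show ?thesis by (simp add: gH_component HH_def)
qed

lemma GDERIV_G: "x \<in> S \<Longrightarrow> GDERIV G x :> gG x"
  unfolding G_def[abs_def] gG_def by (intro GDERIV_mult GDERIV_E GDERIV_H)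

lemma GDERIV_gG: "x \<in> S \<Longrightarrow> GDERIV (\<lambda>x. gG x $ j) x :>
    (E x *\<^sub>R HH x j + gH x $ j *\<^sub>R gE x) + (H x *\<^sub>R EE x j + gE x $ j *\<^sub>R gH x)"
  unfolding gG_def vector_add_component vector_scaleR_component real_scaleR_def
  by (intro GDERIV_add GDERIV_mult GDERIV_E GDERIV_H GDERIV_gE GDERIV_gH)

lemma GDERIV_F: "x \<in> S \<Longrightarrow> GDERIV F x :> gF x"
proof -
  assume x: "x \<in> S"
  note pos = U_pos[OF x] H_pos[OF x]
  have dp: "DERIV (\<lambda>y. y powr b) y :> b / y * y powr b" if "y > 0" for b y :: real
    using has_real_derivative_powr[OF that, of b] that by (simp add: powr_diff)
  have "GDERIV (\<lambda>x. U x powr a * H x powr (q / 2)) x :>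
     U x powr a *\<^sub>R ((q / 2 / H x * H x powr (q / 2)) *\<^sub>R gH x) + H x powr (q / 2) *\<^sub>R ((a / U x * U x powr a) *\<^sub>R (U x *\<^sub>R V x))"
    by (intro GDERIV_mult GDERIV_DERIV_compose[OF U_deriv[OF x] dp] GDERIV_DERIV_compose[OF GDERIV_H[OF x] dp] pos)
  then show ?thesis unfolding F_def[abs_def] gF_def
    by (rule GDERIV_subst) (use pos in \<open>simp add: scaleR_add_right mult_ac\<close>)
qed

lemma GDERIV_r: "x \<in> S \<Longrightarrow> GDERIV r x :> gr x"
  unfolding r_def[abs_def] gr_def tr_def
  by (intro GDERIV_diff GDERIV_minus GDERIV_sum W_deriv GDERIV_F GDERIV_H)

lemma GDERIV_X: "x \<in> S \<Longrightarrow> GDERIV (\<lambda>x. X x j) x :> DX x j"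
proof -
  assume x: "x \<in> S"
  have "GDERIV (\<lambda>x. (1 / 2) * gG x $ j + (E x * r x) * V x $ j) x :>
    ((1 / 2) *\<^sub>R ((E x *\<^sub>R HH x j + gH x $ j *\<^sub>R gE x) + (H x *\<^sub>R EE x j + gE x $ j *\<^sub>R gH x)) + gG x $ j *\<^sub>R 0)
   + ((E x * r x) *\<^sub>R W x $ j + V x $ j *\<^sub>R (E x *\<^sub>R gr x + r x *\<^sub>R gE x))"
    by (intro GDERIV_add GDERIV_mult GDERIV_const GDERIV_gG GDERIV_E GDERIV_r V_deriv x)
  then show ?thesis by (simp add: X_def DX_def)
qed

lemma continuous_on_jets:
  "continuous_on S U" "continuous_on S V" "continuous_on S W" "continuous_on A \<eta>" "continuous_on A E"
  "continuous_on A gE" "continuous_on A (\<lambda>x. EE x j)" "continuous_on S H" "continuous_on S gH"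
  "continuous_on S G" "continuous_on S gG" "continuous_on S F" "continuous_on S r"
  "continuous_on S (\<lambda>x. HH x j)" "continuous_on S gr" "continuous_on S (\<lambda>x. X x j)" "continuous_on S (\<lambda>x. DX x j)"
proof -
  show U: "continuous_on S U" by (rule GDERIV_imp_continuous_on[OF U_deriv])
  show V: "continuous_on S V" by (rule continuous_on_components, rule GDERIV_imp_continuous_on[OF V_deriv])
  show W: "continuous_on S W"
    by (rule continuous_on_components, rule continuous_on_components, rule GDERIV_imp_continuous_on[OF W_deriv])
  show e: "continuous_on A \<eta>" for A by (rule GDERIV_imp_continuous_on[OF GDERIV_\<eta>])
  show E: "continuous_on A E" for A by (rule GDERIV_imp_continuous_on[OF GDERIV_E])
  show gE: "continuous_on A gE" for A by (rule continuous_on_components, rule GDERIV_imp_continuous_on[OF GDERIV_gE])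
  show EE: "continuous_on A (\<lambda>x. EE x j)" for j A unfolding EE_def by (intro continuous_intros e)
  show H: "continuous_on S H" by (rule GDERIV_imp_continuous_on[OF GDERIV_H])
  show gH: "continuous_on S gH" by (rule continuous_on_components, rule GDERIV_imp_continuous_on[OF GDERIV_gH])
  show "continuous_on S G" by (rule GDERIV_imp_continuous_on[OF GDERIV_G])
  show gG: "continuous_on S gG" by (rule continuous_on_components, rule GDERIV_imp_continuous_on[OF GDERIV_gG])
  show F: "continuous_on S F" by (rule GDERIV_imp_continuous_on[OF GDERIV_F])
  show r: "continuous_on S r" by (rule GDERIV_imp_continuous_on[OF GDERIV_r])
  show HH: "continuous_on S (\<lambda>x. HH x j)" for j
    unfolding HH_def by (intro continuous_intros V W T_cont)
  show gr: "continuous_on S gr"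
    unfolding gr_def gF_def using H_pos by (intro continuous_intros V H gH F T_cont) force
  show "continuous_on S (\<lambda>x. X x j)" by (rule GDERIV_imp_continuous_on[OF GDERIV_X])
  show "continuous_on S (\<lambda>x. DX x j)"
    unfolding DX_def by (intro continuous_intros E gE EE H gH HH W V r gr)
qed

text \<open>The power of \<open>U\<close> produces \<open>a F H\<close>, the term competing with the
  square of F + H; the power of \<open>H\<close> enters through the derivative of \<open>H\<close>
  along \<open>V\<close>.\<close>

lemma V_dot_gF: "x \<in> S \<Longrightarrow> V x \<bullet> gF x = a * F x * H x + q * F x * (V x \<bullet> gH x / (2 * H x))"
  using H_pos by (simp add: gF_def inner_add_right H_def field_simps)

lemma V_dot_gH: "V x \<bullet> gH x = 2 * (V x \<bullet> (W x *v V x))"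
  by (simp add: gH_def dot_rowvector_columnvector[symmetric] inner_commute)
    (metis dot_lmul_matrix inner_commute)

text \<open>The third derivatives cancel, by symmetry of \<open>T\<close>.\<close>

lemma divergence_X:
  assumes x: "x \<in> S"
  shows "(\<Sum>j\<in>UNIV. DX x j $ j) =
    E x * (W x \<bullet> W x - (a * F x * H x + (q * F x + 2 * H x) * (V x \<bullet> gH x / (2 * H x))))
    + gE x \<bullet> gH x + H x * lapE x / 2 + r x * (gE x \<bullet> V x + E x * tr x)"
proof -
  have 1: "(\<Sum>j\<in>UNIV. HH x j $ j) = 2 * (V x \<bullet> (\<Sum>i\<in>UNIV. T x $ i $ i) + W x \<bullet> W x)"
  proof -
    have "(\<Sum>j\<in>UNIV. HH x j $ j) = 2 * ((\<Sum>j\<in>UNIV. \<Sum>i\<in>UNIV. V x $ i * T x $ i $ j $ j)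
        + (\<Sum>j\<in>UNIV. \<Sum>i\<in>UNIV. W x $ i $ j * W x $ i $ j))"
      by (simp add: HH_def sum_distrib_left[symmetric] sum.distrib)
    also have "(\<Sum>j\<in>UNIV. \<Sum>i\<in>UNIV. W x $ i $ j * W x $ i $ j) = W x \<bullet> W x"
      by (subst sum.swap) (simp add: inner_vec_def)
    \<comment> \<open>Symmetry turns the Laplacian of each component of \<open>V\<close> into a
      partial derivative of the trace of \<open>W\<close>.\<close>
    also have "(\<Sum>j\<in>UNIV. \<Sum>i\<in>UNIV. V x $ i * T x $ i $ j $ j) = (\<Sum>j\<in>UNIV. \<Sum>i\<in>UNIV. V x $ i * T x $ j $ j $ i)"
      using T_sym[OF x] by (intro sum.cong refl arg_cong2[of _ _ _ _ "(*)"]) metis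
    also have "\<dots> = V x \<bullet> (\<Sum>i\<in>UNIV. T x $ i $ i)"
      by (subst sum.swap) (simp add: inner_vec_def sum_distrib_left)
    finally show ?thesis .
  qed
  have 2: "(\<Sum>j\<in>UNIV. EE x j $ j) = lapE x"
  proof -
    have "EE x j $ j = 8 * ((x - x0) $ j * (x - x0) $ j) - 4 * \<eta> x" for j by (simp add: EE_def)
    then show ?thesis
      by (simp add: lapE_def sum_subtractf inner_vec_def sum_distrib_left del: vector_minus_component)
  qed
  have 3: "(\<Sum>j\<in>UNIV. gH x $ j * gE x $ j) = gE x \<bullet> gH x" "(\<Sum>j\<in>UNIV. gE x $ j * gH x $ j) = gE x \<bullet> gH x"
    by (simp_all add: inner_vec_def mult.commute)
  have 4: "(\<Sum>j\<in>UNIV. W x $ j $ j) = tr x" by (simp add: tr_def)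
  have 5: "(\<Sum>j\<in>UNIV. V x $ j * (E x * gr x $ j + r x * gE x $ j)) = E x * (V x \<bullet> gr x) + r x * (gE x \<bullet> V x)"
    by (simp add: inner_vec_def sum.distrib sum_distrib_left algebra_simps)
  have 6: "V x \<bullet> gr x = - (V x \<bullet> (\<Sum>i\<in>UNIV. T x $ i $ i)) - V x \<bullet> gF x - V x \<bullet> gH x"
    by (simp add: gr_def inner_diff_right)
  have 7: "V x \<bullet> gH x = 2 * H x * (V x \<bullet> gH x / (2 * H x))" using H_pos[OF x] by simp
  have "(\<Sum>j\<in>UNIV. DX x j $ j) = (1 / 2) * ((E x * (\<Sum>j\<in>UNIV. HH x j $ j) + (\<Sum>j\<in>UNIV. gH x $ j * gE x $ j))
      + (H x * (\<Sum>j\<in>UNIV. EE x j $ j) + (\<Sum>j\<in>UNIV. gE x $ j * gH x $ j)))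
      + ((E x * r x) * (\<Sum>j\<in>UNIV. W x $ j $ j) + (\<Sum>j\<in>UNIV. V x $ j * (E x * gr x $ j + r x * gE x $ j)))"
  proof -
    have "DX x j $ j = (1 / 2) * ((E x * HH x j $ j + gH x $ j * gE x $ j) + (H x * EE x j $ j + gE x $ j * gH x $ j))
        + ((E x * r x) * W x $ j $ j + V x $ j * (E x * gr x $ j + r x * gE x $ j))" for j
      by (simp add: DX_def)
    then show ?thesis by (simp only: sum.distrib sum_distrib_left[symmetric])
  qed
  also have "\<dots> = E x * (W x \<bullet> W x) + gE x \<bullet> gH x + H x * lapE x / 2
      - E x * (V x \<bullet> gF x + V x \<bullet> gH x) + r x * (gE x \<bullet> V x + E x * tr x)"
    unfolding 1 2 3 4 5 6 by (simp add: algebra_simps)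
  also have "V x \<bullet> gF x + V x \<bullet> gH x = a * F x * H x + (q * F x + 2 * H x) * (V x \<bullet> gH x / (2 * H x))"
    unfolding V_dot_gF[OF x] by (subst 7) (simp add: algebra_simps)
  finally show ?thesis by (simp add: algebra_simps)
qed

text \<open>The truncated power vanishes off \<open>M\<close>, so
  \<open>set_integral_gradient_eq_0\<close> applies to its product with each component of
  \<open>X\<close>; component j contributes entry j of its gradient to the divergence.\<close>

lemma integral_divergence_eq_0:
  fixes k :: real and n :: nat
  assumes M: "compact M" "M \<subseteq> S" and le: "\<And>x. x \<in> S \<Longrightarrow> x \<notin> M \<Longrightarrow> G x \<le> k"
  defines "\<phi> \<equiv> \<lambda>x. max 0 (G x - k) ^ (n + 2)" and "\<phi>' \<equiv> \<lambda>x. real (n + 2) * max 0 (G x - k) ^ (n + 1)"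
  shows "(LINT x:M|lborel. \<phi> x * (\<Sum>j\<in>UNIV. DX x j $ j) + \<phi>' x * (\<Sum>j\<in>UNIV. X x j * gG x $ j)) = 0"
    and "set_integrable lborel M (\<lambda>x. \<phi> x * (\<Sum>j\<in>UNIV. DX x j $ j) + \<phi>' x * (\<Sum>j\<in>UNIV. X x j * gG x $ j))"
proof -
  define DY where "DY x j = \<phi> x *\<^sub>R DX x j + X x j *\<^sub>R (\<phi>' x *\<^sub>R gG x)" for x j
  have d\<phi>: "GDERIV \<phi> x :> \<phi>' x *\<^sub>R gG x" if "x \<in> S" for x
    unfolding \<phi>_def \<phi>'_def
    using GDERIV_DERIV_compose[OF GDERIV_diff[OF GDERIV_G[OF that] GDERIV_const] DERIV_pos_part_power] by simp
  have dY: "GDERIV (\<lambda>x. \<phi> x * X x j) x :> DY x j" if "x \<in> S" for x j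
    unfolding DY_def by (intro GDERIV_mult d\<phi> GDERIV_X that)
  have cont: "continuous_on S (\<lambda>x. DY x j)" for j
    unfolding DY_def \<phi>_def \<phi>'_def by (intro continuous_intros continuous_on_jets)
  have 0: "(LINT x:M|lborel. DY x j) = 0" for j
  proof (rule set_integral_gradient_eq_0[OF open_S M dY cont])
    fix x assume "x \<in> S" "x \<notin> M"
    then have "max 0 (G x - k) = 0" using le by simp
    then show "\<phi> x * X x j = 0" by (simp add: \<phi>_def)
  qed
  have int: "set_integrable lborel M (\<lambda>x. DY x j)" for j
    unfolding set_integrable_def using M by (intro borel_integrable_compact continuous_on_subset[OF cont]) auto
  have sum_eq: "(\<Sum>j\<in>UNIV. DY x j $ j) = \<phi> x * (\<Sum>j\<in>UNIV. DX x j $ j) + \<phi>' x * (\<Sum>j\<in>UNIV. X x j * gG x $ j)" for x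
    by (simp add: DY_def sum.distrib sum_distrib_left mult_ac)
  have intj: "set_integrable lborel M (\<lambda>x. DY x j $ j)" for j
    unfolding set_integrable_def using M
    by (intro borel_integrable_compact continuous_intros continuous_on_subset[OF cont]) auto
  have "(LINT x:M|lborel. DY x j $ j) = 0" for j
  proof -
    have "(LINT x:M|lborel. DY x j $ j) = (LINT x:M|lborel. DY x j) $ j"
      using integral_bounded_linear[OF bounded_linear_vec_nth[of j] int[of j, unfolded set_integrable_def]]
      by (simp add: set_lebesgue_integral_def)
    then show ?thesis by (simp add: 0)
  qed
  moreover have ind: "indicator M x *\<^sub>R (\<Sum>j\<in>UNIV. DY x j $ j) = (\<Sum>j\<in>UNIV. indicator M x *\<^sub>R DY x j $ j)" for x
    by (rule scaleR_sum_right)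
  ultimately have "(LINT x:M|lborel. (\<Sum>j\<in>UNIV. DY x j $ j)) = 0"
    using Bochner_Integration.integral_sum[of UNIV lborel "\<lambda>j x. indicator M x *\<^sub>R DY x j $ j"]
      intj[unfolded set_integrable_def]
    by (simp only: set_lebesgue_integral_def sum.neutral_const)
  then show "(LINT x:M|lborel. \<phi> x * (\<Sum>j\<in>UNIV. DX x j $ j) + \<phi>' x * (\<Sum>j\<in>UNIV. X x j * gG x $ j)) = 0"
    by (simp only: sum_eq)
  have "set_integrable lborel M (\<lambda>x. \<Sum>j\<in>UNIV. DY x j $ j)"
    unfolding set_integrable_def ind
    by (rule Bochner_Integration.integrable_sum) (rule intj[unfolded set_integrable_def])
  then show "set_integrable lborel M (\<lambda>x. \<phi> x * (\<Sum>j\<in>UNIV. DX x j $ j) + \<phi>' x * (\<Sum>j\<in>UNIV. X x j * gG x $ j))"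
    by (simp only: sum_eq)
qed

end

section \<open>Superlevel sets of the gradient\<close>

text \<open>Here \<open>t\<close> is the truncation (G - k)_+, \<open>\<gamma>\<close> the norm of
  \<open>gG\<close>, A + r d the divergence of \<open>X\<close>, and \<gamma>^2/2 + r e the product
  X \<bullet> gG. Differentiating the power of \<open>t\<close> yields \<gamma>^2 with weight n + 2
  and one factor \<open>t\<close> fewer than the drift B \<gamma> carries; since t \<le> L, a large
  \<open>n\<close> lets it dominate.\<close>

lemma absorption:
  fixes t \<gamma> r A d e :: real
  assumes t: "0 \<le> t" "t \<le> L" and r: "\<bar>r\<bar> \<le> \<delta>" and "\<kappa> > 0" "0 \<le> B" "0 \<le> B2" "0 \<le> B3" "0 \<le> \<gamma>"
    and small: "(B + B2) * \<delta> \<le> \<kappa> / 2" and large: "4 * B\<^sup>2 * L \<le> real (n + 2) * \<kappa>"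
    and A: "\<kappa> - B * \<gamma> - B * \<bar>r\<bar> \<le> A" and d: "\<bar>d\<bar> \<le> B2" and e: "\<bar>e\<bar> \<le> B3 * \<gamma>"
  shows "\<kappa> / 4 * t ^ (n + 2) - real (n + 2) * t ^ (n + 1) * (B3\<^sup>2 * \<delta>\<^sup>2)
    \<le> t ^ (n + 2) * (A + r * d) + real (n + 2) * t ^ (n + 1) * (\<gamma>\<^sup>2 / 2 + r * e)"
proof -
  let ?m = "real (n + 2)"
  \<comment> \<open>The errors proportional to \<open>r\<close> use up at most half of
    \<open>\<kappa>\<close>.\<close>
  have "\<bar>r * d\<bar> \<le> \<delta> * B2" unfolding abs_mult using r d by (intro mult_mono) auto
  moreover have "B * \<bar>r\<bar> \<le> B * \<delta>" using assms by (intro mult_left_mono) auto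
  ultimately have 1: "\<kappa> / 2 - B * \<gamma> \<le> A + r * d" using A small by (simp add: algebra_simps abs_if split: if_splits)
  \<comment> \<open>Half of \<gamma>^2/2 pays for \<open>r e\<close>; the other half is reserved for
    the drift.\<close>
  have "\<bar>r * e\<bar> \<le> \<delta> * (B3 * \<gamma>)" unfolding abs_mult using r e by (intro mult_mono) auto
  moreover have "\<gamma> * (\<delta> * B3) \<le> 1 / 4 * \<gamma>\<^sup>2 + (\<delta> * B3)\<^sup>2 / (4 * (1 / 4))" by (rule mult_le_square_plus) simp
  ultimately have 2: "\<gamma>\<^sup>2 / 4 - B3\<^sup>2 * \<delta>\<^sup>2 \<le> \<gamma>\<^sup>2 / 2 + r * e"
    by (simp add: algebra_simps power_mult_distrib abs_if split: if_splits)
  \<comment> \<open>Young's inequality with the weight (n + 2)/4 still available for \<gamma>^2; the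
    remainder t^2 B^2/(n + 2) is at most t \<kappa>/4 by \<open>large\<close>.\<close>
  have "\<gamma> * (t * B) \<le> ?m / 4 * \<gamma>\<^sup>2 + (t * B)\<^sup>2 / (4 * (?m / 4))" by (rule mult_le_square_plus) simp
  also have "(t * B)\<^sup>2 / (4 * (?m / 4)) = t * ((4 * B\<^sup>2 * t) / (4 * ?m))"
    by (simp add: power_mult_distrib power2_eq_square)
  also have "\<dots> \<le> t * (\<kappa> / 4)"
  proof (rule mult_left_mono)
    have cancel: "M * \<kappa> / (4 * M) = \<kappa> / 4" if "M > 0" for M :: real using that by simp
    have "4 * B\<^sup>2 * t \<le> 4 * B\<^sup>2 * L" using t by (intro mult_left_mono) auto
    then have "4 * B\<^sup>2 * t \<le> ?m * \<kappa>" using large by linarith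
    then have "(4 * B\<^sup>2 * t) / (4 * ?m) \<le> (?m * \<kappa>) / (4 * ?m)" by (rule divide_right_mono) simp
    also have "\<dots> = \<kappa> / 4" by (rule cancel) simp
    finally show "(4 * B\<^sup>2 * t) / (4 * ?m) \<le> \<kappa> / 4" .
  qed (use t in simp)
  finally have 3: "\<gamma> * (t * B) \<le> ?m / 4 * \<gamma>\<^sup>2 + t * (\<kappa> / 4)" by simp
  have "t * (\<kappa> / 2 - B * \<gamma>) \<le> t * (A + r * d)" using 1 t by (intro mult_left_mono) auto
  then have 4: "\<kappa> / 2 * t - \<gamma> * (t * B) \<le> t * (A + r * d)" by (simp add: algebra_simps)
  have "?m * (\<gamma>\<^sup>2 / 4 - B3\<^sup>2 * \<delta>\<^sup>2) \<le> ?m * (\<gamma>\<^sup>2 / 2 + r * e)" using 2 by (intro mult_left_mono) auto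
  then have 5: "?m / 4 * \<gamma>\<^sup>2 - ?m * (B3\<^sup>2 * \<delta>\<^sup>2) \<le> ?m * (\<gamma>\<^sup>2 / 2 + r * e)"
    unfolding right_diff_distrib by simp
  have arith: "k4 - md \<le> tA + mR" if "k2 - gB \<le> tA" "mg - md \<le> mR" "gB \<le> mg + k4" "k2 = 2 * k4"
    for k4 md tA mR k2 gB mg :: real using that by linarith
  have "\<kappa> / 4 * t - ?m * (B3\<^sup>2 * \<delta>\<^sup>2) \<le> t * (A + r * d) + ?m * (\<gamma>\<^sup>2 / 2 + r * e)"
    using 3 by (intro arith[OF 4 5]) (simp_all add: mult.commute)
  then have "t ^ (n + 1) * (\<kappa> / 4 * t - ?m * (B3\<^sup>2 * \<delta>\<^sup>2)) \<le> t ^ (n + 1) * (t * (A + r * d) + ?m * (\<gamma>\<^sup>2 / 2 + r * e))"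
    using t by (intro mult_left_mono) auto
  moreover have "t ^ (n + 1) * (x * t - y * z) = x * t ^ (n + 2) - y * t ^ (n + 1) * z"
    "t ^ (n + 1) * (t * x + y * z) = t ^ (n + 2) * x + y * t ^ (n + 1) * z" for x y z
    by (simp_all add: algebra_simps)
  ultimately show ?thesis by (simp only:)
qed

context log_gradient
begin

lemma F_nonneg: "x \<in> S \<Longrightarrow> F x \<ge> 0"
  by (simp add: F_def)

text \<open>Where G \<ge> k, the bound E \<le> R^4 forces H \<ge> h0, and H \<le> h1 forces \<eta>
  \<ge> \<eta>0. \<open>B2\<close>, and \<open>B3\<close> times the norm of \<open>gG\<close>, bound
  the factors of \<open>r\<close> in the divergence of \<open>X\<close> and in X \<bullet> gG. The
  13 in \<open>ck\<close>, against 12 in the pointwise inequality, leaves a surplus H R^2 \<ge> h0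
  R^2 = \<kappa>, which drives the estimate.\<close>

lemma superlevel_integral_estimate:
  fixes n :: nat
  assumes N: "CARD('n) \<ge> 2"
    and form: "\<And>F H s. F \<ge> 0 \<Longrightarrow> H \<ge> 0 \<Longrightarrow>
      c * H\<^sup>2 - C * s\<^sup>2 \<le> (F + H + s)\<^sup>2 / (real CARD('n) - 1) - a * F * H - (q * F + 2 * H) * s"
    and cC: "c > 0" "C \<ge> 0" and R: "R > 0" and k: "k > 0"
    and ck: "(4 * C + 13 + 2 * real CARD('n)) * R\<^sup>2 \<le> c * k"
    and M: "compact M" "M \<subseteq> S" "\<And>x. x \<in> S \<Longrightarrow> x \<notin> M \<Longrightarrow> G x \<le> k"
    and on_M: "\<And>x. x \<in> M \<Longrightarrow> k \<le> G x" "\<And>x. x \<in> M \<Longrightarrow> x \<in> ball x0 R" "\<And>x. x \<in> M \<Longrightarrow> H x \<le> h1"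
      "\<And>x. x \<in> M \<Longrightarrow> F x \<le> f1" "\<And>x. x \<in> M \<Longrightarrow> \<bar>r x\<bar> \<le> \<delta>"
    and h1: "h1 > 0" and \<delta>: "\<delta> \<le> 1" and f1: "f1 \<ge> 0"
    and \<eta>0: "\<eta>0 = sqrt (k / h1)" and h0: "h0 = k / R ^ 4" and \<kappa>: "\<kappa> = k / R\<^sup>2"
    and s1: "s1 = 2 * (h1 + 1) * R / \<eta>0" and m: "m = f1 + h1 + s1"
    and B: "B = (h1 + 1) / (2 * h0) * (2 * m + \<bar>q\<bar> * f1 + 2 * h1) + 4 * R / \<eta>0 + 2 * R ^ 4 * m"
    and B2: "B2 = 4 * R ^ 3 * (h1 + 1) + R ^ 4 * (f1 + h1 + 1)" and B3: "B3 = R ^ 4 * (h1 + 1)"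
    and small: "(B + B2) * \<delta> \<le> \<kappa> / 2" and large: "4 * B\<^sup>2 * (R ^ 4 * h1) \<le> real (n + 2) * \<kappa>"
  shows "\<kappa> / 4 * (LINT x:M|lborel. max 0 (G x - k) ^ (n + 2))
    \<le> real (n + 2) * (R ^ 4 * h1) ^ (n + 1) * (B3\<^sup>2 * \<delta>\<^sup>2) * measure lborel (cball x0 R)"
proof -
  let ?t = "\<lambda>x. max 0 (G x - k)"
  let ?f = "\<lambda>x. ?t x ^ (n + 2) * (\<Sum>j\<in>UNIV. DX x j $ j) + (real (n + 2) * ?t x ^ (n + 1)) * (\<Sum>j\<in>UNIV. X x j * gG x $ j)"
  let ?e = "real (n + 2) * (R ^ 4 * h1) ^ (n + 1) * (B3\<^sup>2 * \<delta>\<^sup>2)"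
  have pos: "\<kappa> > 0" "h0 > 0" "\<eta>0 > 0" using k R h1 by (simp_all add: \<kappa> h0 \<eta>0)
  have s1_0: "s1 \<ge> 0" using h1 R pos by (simp add: s1)
  have m0: "m \<ge> 0" using f1 h1 s1_0 by (simp add: m)
  have B0: "B \<ge> 0" "B2 \<ge> 0" "B3 \<ge> 0" using pos m0 f1 h1 R by (simp_all add: B B2 B3)
  have nu: "real CARD('n) - 1 \<ge> 1" using N by simp
  have lower: "\<kappa> / 4 * ?t x ^ (n + 2) - ?e \<le> ?f x" if x: "x \<in> M" for x
  proof -
    have xS: "x \<in> S" using M x by blast
    let ?z = "x - x0"
    have nz: "norm ?z < R" using on_M(2)[OF x] by (simp add: dist_norm norm_minus_commute)
    have zz: "?z \<bullet> ?z < R\<^sup>2"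
    proof -
      have "(norm ?z)\<^sup>2 < R\<^sup>2" using nz by (intro power_strict_mono) auto
      then show ?thesis by (simp add: dot_square_norm)
    qed
    have eta: "\<eta> x > 0" "\<eta> x \<le> R\<^sup>2" using zz by (simp_all add: \<eta>_def)
    have E: "E x > 0" "E x \<le> R ^ 4"
    proof -
      have "(\<eta> x)\<^sup>2 \<le> (R\<^sup>2)\<^sup>2" using eta by (intro power_mono) auto
      then show "E x \<le> R ^ 4" by (simp add: E_def)
    qed (use eta in \<open>simp add: E_def\<close>)
    have H: "H x > 0" "H x \<le> h1" using H_pos[OF xS] on_M(3)[OF x] by auto
    have F: "F x \<ge> 0" "F x \<le> f1" using F_nonneg[OF xS] on_M(4)[OF x] by auto
    have k_le: "k \<le> E x * H x" using on_M(1)[OF x] by (simp add: G_def)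
    also have "\<dots> \<le> R ^ 4 * H x" using E H by (intro mult_right_mono) auto
    finally have H0: "h0 \<le> H x" using R by (simp add: h0 divide_le_eq mult.commute)
    have eta0: "\<eta>0 \<le> \<eta> x"
    proof -
      have "E x * H x \<le> E x * h1" using E H by (intro mult_left_mono) auto
      then have "k / h1 \<le> (\<eta> x)\<^sup>2" using k_le h1 by (simp add: divide_le_eq E_def)
      then show ?thesis unfolding \<eta>0 using eta real_le_lsqrt by (metis less_imp_le real_sqrt_le_iff real_sqrt_unique)
    qed
    define s where "s = 2 * (V x \<bullet> ?z) / \<eta> x"
    let ?A = "E x * (W x \<bullet> W x - (a * F x * H x + (q * F x + 2 * H x) * (V x \<bullet> gH x / (2 * H x)))) + gE x \<bullet> gH x + H x * lapE x / 2"
    have tr: "tr x = - F x - H x - r x" by (simp add: r_def)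
    have I: "H x * (c * (E x * H x) - (4 * C + 12 + 2 * real CARD('n)) * R\<^sup>2)
      + (V x \<bullet> gG x) / (2 * H x) * (2 * (F x + H x + s) / (real CARD('n) - 1) - q * F x - 2 * H x)
      + 2 * E x * (F x + H x + s) * r x / (real CARD('n) - 1) - 4 * (?z \<bullet> gG x) / \<eta> x \<le> ?A"
      by (rule bernstein_pointwise_identity[OF form cC(2) refl nu eta less_imp_le[OF zz] E_def gE_def lapE_def H_def H(1) F(1) _ V_dot_gH gG_def refl s_def])
        (use tr in \<open>simp_all add: tr_def\<close>)
    have II: "- (B * norm (gG x)) - B * \<bar>r x\<bar> \<le> (V x \<bullet> gG x) / (2 * H x) * (2 * (F x + H x + s) / (real CARD('n) - 1) - q * F x - 2 * H x)
      + 2 * E x * (F x + H x + s) * r x / (real CARD('n) - 1) - 4 * (?z \<bullet> gG x) / \<eta> x"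
      by (rule bernstein_pointwise_error[OF nu pos(2) H0 H(2) H_def F pos(3) eta0 eta(2) less_imp_le[OF zz] R E_def s_def s1 m B])
    have III: "\<kappa> \<le> H x * (c * (E x * H x) - (4 * C + 12 + 2 * real CARD('n)) * R\<^sup>2)"
    proof -
      have "c * k \<le> c * (E x * H x)" using k_le cC by (intro mult_left_mono) auto
      then have *: "R\<^sup>2 \<le> c * (E x * H x) - (4 * C + 12 + 2 * real CARD('n)) * R\<^sup>2"
        using ck by (simp add: algebra_simps)
      have "\<kappa> = h0 * R\<^sup>2" using R by (simp add: \<kappa> h0 power4_eq_xxxx power2_eq_square)
      also have "\<dots> \<le> H x * (c * (E x * H x) - (4 * C + 12 + 2 * real CARD('n)) * R\<^sup>2)"
        using H0 * H pos by (intro mult_mono) auto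
      finally show ?thesis .
    qed
    have A: "\<kappa> - B * norm (gG x) - B * \<bar>r x\<bar> \<le> ?A"
    proof -
      have arith: "\<kappa> - b - b' \<le> A'" if "\<kappa> \<le> h" "- b - b' \<le> u + v - w" "h + u + v - w \<le> A'"
        for b b' A' h u v w :: real using that by linarith
      show ?thesis by (rule arith[OF III II I])
    qed
    have nV: "norm (V x) \<le> h1 + 1"
    proof -
      have "(norm (V x))\<^sup>2 \<le> h1" using H by (simp add: H_def dot_square_norm)
      moreover have "0 \<le> (norm (V x) - 1)\<^sup>2" by simp
      then have "2 * norm (V x) \<le> (norm (V x))\<^sup>2 + 1" by (simp add: power2_eq_square algebra_simps)
      ultimately show ?thesis using h1 by linarith
    qed
    have d: "\<bar>gE x \<bullet> V x + E x * tr x\<bar> \<le> B2"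
    proof -
      have "norm (gE x) \<le> 4 * R\<^sup>2 * R"
        using eta nz R by (simp add: gE_def abs_mult) (intro mult_mono, auto)
      then have "norm (gE x) * norm (V x) \<le> (4 * R\<^sup>2 * R) * (h1 + 1)" using nV R by (intro mult_mono) auto
      then have 1: "\<bar>gE x \<bullet> V x\<bar> \<le> 4 * R ^ 3 * (h1 + 1)"
        using Cauchy_Schwarz_ineq2[of "gE x" "V x"] by (simp add: power3_eq_cube power2_eq_square mult.assoc)
      have "\<bar>tr x\<bar> \<le> f1 + h1 + 1" unfolding tr using F H on_M(5)[OF x] \<delta> by linarith
      then have "\<bar>E x * tr x\<bar> \<le> R ^ 4 * (f1 + h1 + 1)" unfolding abs_mult using E by (intro mult_mono) auto
      then show ?thesis using 1 unfolding B2 by linarith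
    qed
    have e: "\<bar>E x * (V x \<bullet> gG x)\<bar> \<le> B3 * norm (gG x)"
    proof -
      have "\<bar>V x \<bullet> gG x\<bar> \<le> (h1 + 1) * norm (gG x)"
        using Cauchy_Schwarz_ineq2[of "V x" "gG x"] mult_right_mono[OF nV norm_ge_zero[of "gG x"]] by linarith
      then have "\<bar>E x\<bar> * \<bar>V x \<bullet> gG x\<bar> \<le> R ^ 4 * ((h1 + 1) * norm (gG x))"
        using E by (intro mult_mono) auto
      then show ?thesis by (simp add: B3 abs_mult mult.assoc)
    qed
    have t: "0 \<le> ?t x" "?t x \<le> R ^ 4 * h1"
    proof -
      have "E x * H x \<le> R ^ 4 * h1" using E H by (intro mult_mono) auto
      then show "?t x \<le> R ^ 4 * h1" using k R h1 by (simp add: G_def)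
    qed simp
    have DX: "(\<Sum>j\<in>UNIV. DX x j $ j) = ?A + r x * (gE x \<bullet> V x + E x * tr x)"
      by (rule divergence_X[OF xS])
    have X: "(\<Sum>j\<in>UNIV. X x j * gG x $ j) = (norm (gG x))\<^sup>2 / 2 + r x * (E x * (V x \<bullet> gG x))"
    proof -
      have "(\<Sum>j\<in>UNIV. X x j * gG x $ j) = (\<Sum>j\<in>UNIV. (1 / 2) * (gG x $ j * gG x $ j) + (r x * E x) * (V x $ j * gG x $ j))"
        by (intro sum.cong refl) (simp add: X_def algebra_simps)
      also have "\<dots> = (1 / 2) * (gG x \<bullet> gG x) + (r x * E x) * (V x \<bullet> gG x)"
        by (simp only: sum.distrib sum_distrib_left[symmetric] inner_vec_def inner_real_def)
      finally show ?thesis by (simp add: dot_square_norm)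
    qed
    have "\<kappa> / 4 * ?t x ^ (n + 2) - real (n + 2) * ?t x ^ (n + 1) * (B3\<^sup>2 * \<delta>\<^sup>2) \<le> ?f x"
      unfolding DX X
      by (rule absorption[OF t on_M(5)[OF x] pos(1) B0 norm_ge_zero small large A d e])
    moreover have "real (n + 2) * ?t x ^ (n + 1) * (B3\<^sup>2 * \<delta>\<^sup>2) \<le> ?e"
      using t by (intro mult_right_mono mult_left_mono power_mono) auto
    ultimately show ?thesis by linarith
  qed
  have contG: "continuous_on M G" using continuous_on_jets(10) M continuous_on_subset by blast
  have i1: "set_integrable lborel M (\<lambda>x. \<kappa> / 4 * ?t x ^ (n + 2))"
    unfolding set_integrable_def by (intro borel_integrable_compact M continuous_intros contG)
  have i2: "set_integrable lborel M (\<lambda>x. ?e)"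
    unfolding set_integrable_def by (intro borel_integrable_compact M continuous_intros)
  note div = integral_divergence_eq_0[OF M, of n]
  have "(LINT x:M|lborel. \<kappa> / 4 * ?t x ^ (n + 2) - ?e) \<le> (LINT x:M|lborel. ?f x)"
    by (rule set_integral_mono[OF set_integral_diff(1)[OF i1 i2] div(2) lower])
  also have "\<dots> = 0" by (rule div(1))
  finally have "\<kappa> / 4 * (LINT x:M|lborel. ?t x ^ (n + 2)) \<le> (LINT x:M|lborel. ?e)"
    using set_integral_diff(2)[OF i1 i2] by simp
  also have "\<dots> = ?e * measure lborel M"
    using compact_imp_closed[OF M(1)] emeasure_compact_finite[OF M(1)]
    by (simp add: set_lebesgue_integral_def mult.commute)
  also have "\<dots> \<le> ?e * measure lborel (cball x0 R)"
  proof (rule mult_left_mono)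
    show "measure lborel M \<le> measure lborel (cball x0 R)"
    proof (rule measure_mono_fmeasurable)
      show "M \<subseteq> cball x0 R" using on_M(2) by (auto simp: less_imp_le)
      show "M \<in> sets lborel" using compact_imp_closed[OF M(1)] by simp
      show "cball x0 R \<in> fmeasurable lborel"
        by (rule fmeasurableI) (use emeasure_compact_finite[OF compact_cball] in simp_all)
    qed
    show "0 \<le> ?e" using R h1 by simp
  qed
  finally show ?thesis .
qed

end

section \<open>The gradient estimate\<close>

lemma log_gradient_logarithm:
  fixes U :: "real^'n \<Rightarrow> real"
  assumes d1: "\<And>x. GDERIV U x :> DU x"
    and d2: "\<And>x i. GDERIV (\<lambda>x. DU x $ i) x :> D2U x $ i"
    and d3: "\<And>x i j. GDERIV (\<lambda>x. D2U x $ i $ j) x :> D3U x $ i $ j"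
    and c3: "continuous_on UNIV D3U"
    and sym: "\<And>x i j. D2U x $ i $ j = D2U x $ j $ i"
      "\<And>x i j k. D3U x $ i $ j $ k = D3U x $ i $ k $ j"
    and S: "open S" "\<And>x. x \<in> S \<Longrightarrow> U x > 0" "\<And>x. x \<in> S \<Longrightarrow> DU x \<noteq> 0"
  defines "V \<equiv> \<lambda>x. inverse (U x) *\<^sub>R DU x"
    and "W \<equiv> \<lambda>x. \<chi> i. inverse (U x) *\<^sub>R D2U x $ i - (inverse (U x) * DU x $ i) *\<^sub>R (inverse (U x) *\<^sub>R DU x)"
  shows "\<exists>T. log_gradient U V W T S"
proof -
  define T where "T x = (\<chi> i j. inverse (U x) *\<^sub>R D3U x $ i $ j - (inverse (U x) * D2U x $ i $ j) *\<^sub>R V x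
    - (V x $ i *\<^sub>R W x $ j + V x $ j *\<^sub>R W x $ i))" for x
  have W: "W x $ i $ j = inverse (U x) * D2U x $ i $ j - V x $ i * V x $ j" for x i j
    by (simp add: W_def V_def)
  \<comment> \<open>The two functions \<open>D2U x $ i $ j\<close> and \<open>D2U x $ j $ i\<close>
    coincide, hence so do their gradients.\<close>
  have sym3: "D3U x $ i $ j = D3U x $ j $ i" for x i j
    using grad_eq[OF d3[of i j x]] grad_eq[OF d3[of j i x]] by (simp add: sym(1)[of _ i j])
  have dinv: "GDERIV (\<lambda>x. inverse (U x)) x :> - (inverse (U x))\<^sup>2 *\<^sub>R DU x" if "x \<in> S" for x
    using S(2)[OF that] by (intro GDERIV_inverse d1) auto
  have dV: "GDERIV (\<lambda>x. V x $ i) x :> W x $ i" if "x \<in> S" for x i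
    using GDERIV_mult[OF dinv[OF that] d2[of i x]] unfolding V_def vector_scaleR_component real_scaleR_def
    by (rule GDERIV_subst) (simp add: W_def vec_eq_iff power2_eq_square)
  have dW: "GDERIV (\<lambda>x. W x $ i $ j) x :> T x $ i $ j" if "x \<in> S" for x i j
    using GDERIV_diff[OF GDERIV_mult[OF dinv[OF that] d3[of i j x]] GDERIV_mult[OF dV[OF that, of i] dV[OF that, of j]]]
    unfolding W by (rule GDERIV_subst) (simp add: T_def V_def vec_eq_iff power2_eq_square)
  have cU: "continuous_on S U" by (rule GDERIV_imp_continuous_on[OF d1])
  have cinv: "continuous_on S (\<lambda>x. inverse (U x))" using S(2) cU by (intro continuous_intros) force+
  have cV: "continuous_on S V" by (rule continuous_on_components, rule GDERIV_imp_continuous_on[OF dV])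
  have cW: "continuous_on S W"
    by (rule continuous_on_components, rule continuous_on_components, rule GDERIV_imp_continuous_on[OF dW])
  have c2: "continuous_on S D2U"
    by (rule continuous_on_components, rule continuous_on_components, rule GDERIV_imp_continuous_on[OF d3])
  have c3': "continuous_on S D3U" using c3 continuous_on_subset by blast
  have "log_gradient U V W T S"
  proof
    show "GDERIV U x :> U x *\<^sub>R V x" if "x \<in> S" for x using d1[of x] S(2)[OF that] by (simp add: V_def)
    show "continuous_on S T" unfolding T_def
      by (intro continuous_on_vec_lambda continuous_intros cinv cV cW c2 c3')
    show Ws: "W x $ i $ j = W x $ j $ i" for x i j unfolding W using sym(1)[of x i j] by simp
    show "T x $ i $ j $ k = T x $ j $ i $ k" for x i j k
      using sym(1)[of x i j] by (simp add: T_def sym3[of x i j])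
    show "T x $ i $ j $ k = T x $ i $ k $ j" for x i j k
      using sym(1)[of x j k] sym(1)[of x i k] sym(1)[of x i j]
      by (simp add: T_def sym(2)[of x i j k] W algebra_simps)
    show "V x \<noteq> 0" if "x \<in> S" for x using S(2)[OF that] S(3)[OF that] by (simp add: V_def)
  qed (use S dV dW in auto)
  then show ?thesis by blast
qed

lemma dist_Pair_le: "dist (a, b) (c, d) \<le> dist a c + dist b d"
  by (simp add: dist_Pair_Pair sqrt_sum_squares_le_sum)

text \<open>Away from critical points the value infinity does not occur. Divided by
  \<open>u\<close>, the source becomes the expression in u and |grad u|/u that \<open>F\<close>
  evaluates for the mollified solution, so the two can be compared.\<close>

lemma enn2real_source:
  fixes u :: "real^'n \<Rightarrow> real"
  assumes u: "u y > 0" and g: "grad u y \<noteq> 0"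
  shows "enn2real (source p q u y) =
    u y * (u y powr (p + q - 1) * ((grad u y \<bullet> grad u y) / (u y)\<^sup>2) powr (q / 2))"
proof -
  let ?n = "norm (grad u y)"
  have n: "?n > 0" using g by simp
  have sq: "(t\<^sup>2) powr (q / 2) = t powr q" if "t > 0" for t :: real
    using powr_powr[of t 2 "q / 2"] that by simp
  have *: "((grad u y \<bullet> grad u y) / (u y)\<^sup>2) powr (q / 2) = ?n powr q / u y powr q"
    using u n by (simp add: dot_square_norm powr_divide sq)
  have "u y powr (1 + (p + q - 1) - q) = u y * u y powr (p + q - 1) / u y powr q"
    using u by (simp only: powr_diff powr_add powr_one)
  then have "u y powr p * ?n powr q = u y * (u y powr (p + q - 1) * (?n powr q / u y powr q))"
    by simp
  moreover have "enn2real (source p q u y) = u y powr p * ?n powr q"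
    using u g by (simp add: source_def epowr_def enn2real_mult)
  ultimately show ?thesis using * by simp
qed

lemma small_parameter:
  fixes b Q k1 k2 :: real
  assumes "b \<ge> 0" "Q \<ge> 0" "k1 > 0" "k2 > 0"
  obtains \<delta> where "0 < \<delta>" "\<delta> \<le> 1" "b * \<delta> \<le> k1" "Q * \<delta>\<^sup>2 < k2"
proof -
  define \<delta> where "\<delta> = min 1 (min (k1 / (b + 1)) (k2 / (2 * (Q + 1))))"
  have pos: "\<delta> > 0" and 1: "\<delta> \<le> 1" using assms by (simp_all add: \<delta>_def)
  have "\<delta> \<le> k1 / (b + 1)" by (simp add: \<delta>_def)
  then have "(b + 1) * \<delta> \<le> k1" using assms by (simp add: le_divide_eq mult.commute)
  then have "b * \<delta> \<le> k1" using pos by (simp add: distrib_right)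
  moreover have "\<delta> \<le> k2 / (2 * (Q + 1))" by (simp add: \<delta>_def)
  then have "2 * ((Q + 1) * \<delta>) \<le> k2" using assms by (simp add: le_divide_eq mult_ac)
  moreover have "Q * \<delta>\<^sup>2 \<le> (Q + 1) * \<delta>"
  proof -
    have "\<delta> * \<delta> \<le> \<delta> * 1" using pos 1 by (intro mult_left_mono) auto
    then show ?thesis using assms pos by (intro mult_mono) (auto simp: power2_eq_square)
  qed
  moreover have "(Q + 1) * \<delta> > 0" using assms pos by simp
  ultimately show ?thesis using that pos 1 by force
qed

text \<open>If \<open>G\<close> exceeded \<open>k\<close> at the centre, then so it would, by a
  fixed amount on a fixed ball, for every close mollification; this contradicts the integral
  estimate as soon as the defect is small. The radius 2 N R makes room for a cube of half side 2 R
  over which the mollification integrates.\<close>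

lemma logarithmic_gradient_at_center:
  fixes u :: "real^'n \<Rightarrow> real"
  assumes N: "CARD('n) \<ge> 2"
    and form: "\<And>F H s. F \<ge> 0 \<Longrightarrow> H \<ge> 0 \<Longrightarrow>
      c * H\<^sup>2 - C * s\<^sup>2 \<le> (F + H + s)\<^sup>2 / (real CARD('n) - 1) - (p + q - 1) * F * H - (q * F + 2 * H) * s"
    and cC: "c > 0" "C \<ge> 0"
    and \<Omega>: "open \<Omega>" "cball x0 (2 * real CARD('n) * R) \<subseteq> \<Omega>" and R: "R > 0"
    and sol: "positive_weak_solution p q \<Omega> u"
  shows "R\<^sup>2 * ((grad u x0 \<bullet> grad u x0) / (u x0)\<^sup>2) \<le> (4 * C + 13 + 2 * real CARD('n)) / c"
proof (rule ccontr)
  assume contra: "\<not> ?thesis"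
  let ?N = "real CARD('n)"
  define a where "a = p + q - 1"
  note form = form[folded a_def]
  \<comment> \<open>The cutoff equals R^4 at \<open>x0\<close>, so the negated claim says precisely
    that \<open>G0 x0\<close> exceeds this level.\<close>
  define k where "k = (4 * C + 13 + 2 * ?N) / c * R\<^sup>2"
  have k: "k > 0" using cC R by (auto simp: k_def intro!: mult_pos_pos divide_pos_pos add_nonneg_pos)
  have ck: "(4 * C + 13 + 2 * ?N) * R\<^sup>2 \<le> c * k" using cC by (simp add: k_def)
  have Ck: "Ck_on 1 \<Omega> u" and upos: "\<And>x. x \<in> \<Omega> \<Longrightarrow> u x > 0"
    using sol by (auto simp: positive_weak_solution_def)
  note u = Ck_on_1D[OF Ck]
  \<comment> \<open>\<open>h\<close> and \<open>\<Phi>\<close> are functions of the pair (value,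
    gradient), so that \<open>H\<close> and \<open>F\<close> of the mollified solution are their
    values at a nearby pair. Negative q restricts \<open>\<Phi>\<close> to nonzero gradients, hence
    the smaller domain \<open>O2\<close>.\<close>
  define h :: "real \<times> (real^'n) \<Rightarrow> real" where "h w = (snd w \<bullet> snd w) / (fst w)\<^sup>2" for w
  define \<Phi> :: "real \<times> (real^'n) \<Rightarrow> real" where "\<Phi> w = fst w powr a * h w powr (q / 2)" for w
  define O1 :: "(real \<times> (real^'n)) set" where "O1 = {w. fst w > 0}"
  define O2 :: "(real \<times> (real^'n)) set" where "O2 = {w. fst w > 0 \<and> snd w \<noteq> 0}"
  have O1: "open O1" unfolding O1_def by (intro open_Collect_less continuous_intros)
  have O2: "open O2" unfolding O2_def by (intro open_Collect_conj open_Collect_less open_Collect_neq continuous_intros)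
  have h_cont: "continuous_on O1 h" unfolding h_def O1_def by (intro continuous_intros) auto
  have O21: "O2 \<subseteq> O1" by (auto simp: O1_def O2_def)
  have \<Phi>_cont: "continuous_on O2 \<Phi>"
  proof -
    have "continuous_on O2 h" using h_cont O21 continuous_on_subset by blast
    then show ?thesis unfolding \<Phi>_def by (intro continuous_intros) (auto simp: O2_def h_def)
  qed
  define J where "J x = (u x, grad u x)" for x
  have J_cont: "continuous_on \<Omega> J" unfolding J_def by (intro continuous_intros u)
  have JO1: "J ` \<Omega> \<subseteq> O1" using upos by (auto simp: J_def O1_def)
  define \<Omega>' where "\<Omega>' = {x \<in> \<Omega>. grad u x \<noteq> 0}"
  have \<Omega>': "open \<Omega>'"
  proof -
    have "open (\<Omega> \<inter> grad u -` (- {0}))"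
      by (rule continuous_open_preimage[OF u(3) \<Omega>(1)]) (simp add: open_Compl)
    moreover have "\<Omega> \<inter> grad u -` (- {0}) = \<Omega>'" by (auto simp: \<Omega>'_def)
    ultimately show ?thesis by simp
  qed
  have JO2: "J ` \<Omega>' \<subseteq> O2" using upos by (auto simp: J_def O2_def \<Omega>'_def)
  define s where "s x = enn2real (source p q u x)" for x
  have s: "s x = u x * \<Phi> (J x)" if "x \<in> \<Omega>'" for x
    using that upos unfolding s_def \<Omega>'_def
    by (simp add: enn2real_source \<Phi>_def J_def h_def a_def)
  have \<Phi>J_cont: "continuous_on \<Omega>' (\<lambda>x. \<Phi> (J x))"
    by (rule continuous_on_compose2[OF \<Phi>_cont continuous_on_subset[OF J_cont] JO2]) (auto simp: \<Omega>'_def)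
  have s_cont: "continuous_on \<Omega>' s"
  proof -
    have "continuous_on \<Omega>' (\<lambda>x. u x * \<Phi> (J x))"
      by (intro continuous_intros \<Phi>J_cont continuous_on_subset[OF u(2)]) (auto simp: \<Omega>'_def)
    then show ?thesis using s by (simp cong: continuous_on_cong_simp)
  qed

  \<comment> \<open>Cutoff and superlevel set of \<open>u\<close> itself\<close>
  define \<eta> where "\<eta> x = R\<^sup>2 - (x - x0) \<bullet> (x - x0)" for x
  define K where "K = cball x0 R"
  have "?N \<ge> 1" using N by simp
  then have "1 \<le> 2 * ?N" by linarith
  then have "1 * R \<le> (2 * ?N) * R" using less_imp_le[OF R] by (rule mult_right_mono)
  then have "K \<subseteq> cball x0 (2 * ?N * R)" unfolding K_def by (intro subset_cball) simp
  then have K\<Omega>: "K \<subseteq> \<Omega>" using \<Omega>(2) by (rule order_trans)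
  have cK: "compact K" by (simp add: K_def)
  have \<eta>K: "0 \<le> \<eta> x" "\<eta> x \<le> R\<^sup>2" if "x \<in> K" for x
  proof -
    have "(norm (x - x0))\<^sup>2 \<le> R\<^sup>2" using that R by (intro power_mono) (auto simp: K_def dist_norm norm_minus_commute)
    then show "0 \<le> \<eta> x" "\<eta> x \<le> R\<^sup>2" by (simp_all add: \<eta>_def dot_square_norm)
  qed
  have \<eta>4: "(\<eta> x)\<^sup>2 \<le> R ^ 4" if "x \<in> K" for x
    using power_mono[OF \<eta>K(2)[OF that] \<eta>K(1)[OF that], of 2] by simp
  define G0 where "G0 x = (\<eta> x)\<^sup>2 * h (J x)" for x
  have hJ_cont: "continuous_on \<Omega> (\<lambda>x. h (J x))" by (rule continuous_on_compose2[OF h_cont J_cont JO1])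
  have G0_cont: "continuous_on \<Omega> G0" unfolding G0_def \<eta>_def by (intro continuous_intros hJ_cont)
  have x0K: "x0 \<in> K" using R by (simp add: K_def)
  have G0x0: "G0 x0 > k"
  proof -
    have "(4 * C + 13 + 2 * ?N) / c * R\<^sup>2 < R\<^sup>2 * h (J x0) * R\<^sup>2"
      using contra R by (intro mult_strict_right_mono) (auto simp: h_def J_def)
    then show ?thesis by (simp add: k_def G0_def \<eta>_def power4_eq_xxxx power2_eq_square mult_ac)
  qed
  \<comment> \<open>One third of the excess is given up to the variation of \<open>G0\<close> near
    \<open>x0\<close>, one to the mollification, and the last remains as G - k \<ge>
    \<alpha>.\<close>
  define \<alpha> where "\<alpha> = (G0 x0 - k) / 3"
  have \<alpha>: "\<alpha> > 0" using G0x0 by (simp add: \<alpha>_def)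
  have sub: "{x0} \<subseteq> \<Omega>" using x0K K\<Omega> by blast
  obtain \<rho>1 where \<rho>1: "\<rho>1 > 0"
    "\<And>x y. x \<in> {x0} \<Longrightarrow> dist x y < \<rho>1 \<Longrightarrow> y \<in> \<Omega> \<and> dist (G0 x) (G0 y) < \<alpha>"
    by (rule uniform_continuity_near_compact[OF \<Omega>(1) compact_sing sub G0_cont \<alpha>]) (rule that; assumption)
  define \<rho>0 where "\<rho>0 = min \<rho>1 R"
  have \<rho>0: "\<rho>0 > 0" "ball x0 \<rho>0 \<subseteq> K" using \<rho>1 R by (auto simp: \<rho>0_def K_def)
  have G0_ball: "G0 y \<ge> k + 2 * \<alpha>" if "y \<in> ball x0 \<rho>0" for y
    using \<rho>1(2)[of x0 y] that by (auto simp: \<rho>0_def dist_real_def \<alpha>_def field_simps abs_if split: if_splits)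
  \<comment> \<open>At half the level this set contains {G \<ge> k} for every close mollification;
    it depends on \<open>u\<close> alone, so bounds and moduli of continuity can be fixed on it in
    advance.\<close>
  define M0 where "M0 = {x \<in> K. G0 x \<ge> k / 2}"
  have M0K: "M0 \<subseteq> K" by (auto simp: M0_def)
  have M0: "compact M0"
  proof -
    have "closed (K \<inter> G0 -` {k/2..})"
      by (rule continuous_closed_preimage) (use G0_cont K\<Omega> cK in \<open>auto intro: continuous_on_subset compact_imp_closed\<close>)
    then have "compact (K \<inter> (K \<inter> G0 -` {k/2..}))" using cK by (rule compact_Int_closed[rotated])
    moreover have "K \<inter> (K \<inter> G0 -` {k/2..}) = M0" by (auto simp: M0_def)
    ultimately show ?thesis by simp
  qed
  have M0\<Omega>': "M0 \<subseteq> \<Omega>'"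
  proof
    fix x assume x: "x \<in> M0"
    then have "G0 x > 0" using k by (simp add: M0_def)
    then have "grad u x \<noteq> 0" by (auto simp: G0_def h_def J_def)
    then show "x \<in> \<Omega>'" using x M0K K\<Omega> by (auto simp: \<Omega>'_def)
  qed
  \<comment> \<open>The margin 1, here and in \<open>f1\<close>, makes the bounds hold for the
    mollified solution as well.\<close>
  obtain h1 where h1: "h1 > 1" "\<And>x. x \<in> K \<Longrightarrow> h (J x) \<le> h1 - 1"
  proof -
    have "bounded ((\<lambda>x. h (J x)) ` K)"
      using cK hJ_cont K\<Omega> by (intro compact_imp_bounded compact_continuous_image) (auto intro: continuous_on_subset)
    then obtain b where "b > 0" "\<And>x. x \<in> K \<Longrightarrow> \<bar>h (J x)\<bar> \<le> b" unfolding bounded_pos by auto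
    then show thesis using that[of "b + 1"] by force
  qed
  obtain f1 where f1: "f1 > 1" "\<And>x. x \<in> M0 \<Longrightarrow> \<Phi> (J x) \<le> f1 - 1"
  proof -
    have "bounded ((\<lambda>x. \<Phi> (J x)) ` M0)"
      using M0 \<Phi>J_cont M0\<Omega>' by (intro compact_imp_bounded compact_continuous_image) (auto intro: continuous_on_subset)
    then obtain b where "b > 0" "\<And>x. x \<in> M0 \<Longrightarrow> \<bar>\<Phi> (J x)\<bar> \<le> b" unfolding bounded_pos by auto
    then show thesis using that[of "b + 1"] by force
  qed

  \<comment> \<open>Constants fixed before the mollification\<close>
  define \<eta>0 where "\<eta>0 = sqrt (k / h1)"
  define h0 where "h0 = k / R ^ 4"
  define \<kappa> where "\<kappa> = k / R\<^sup>2"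
  define s1 where "s1 = 2 * (h1 + 1) * R / \<eta>0"
  define m where "m = f1 + h1 + s1"
  define B where "B = (h1 + 1) / (2 * h0) * (2 * m + \<bar>q\<bar> * f1 + 2 * h1) + 4 * R / \<eta>0 + 2 * R ^ 4 * m"
  define B2 where "B2 = 4 * R ^ 3 * (h1 + 1) + R ^ 4 * (f1 + h1 + 1)"
  define B3 where "B3 = R ^ 4 * (h1 + 1)"
  have pos: "\<kappa> > 0" "h0 > 0" "\<eta>0 > 0" using k R h1 by (simp_all add: \<kappa>_def h0_def \<eta>0_def)
  have s1_0: "s1 \<ge> 0" using h1 R pos by (simp add: s1_def)
  have m0: "m \<ge> 0" using f1 h1 s1_0 by (simp add: m_def)
  have B0: "B \<ge> 0" "B2 \<ge> 0" using pos m0 f1 h1 R by (simp_all add: B_def B2_def)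
  obtain n where "4 * B\<^sup>2 * (R ^ 4 * h1) / \<kappa> \<le> real n" using real_arch_simple by blast
  then have "4 * B\<^sup>2 * (R ^ 4 * h1) \<le> real n * \<kappa>" using pos by (simp add: divide_le_eq)
  also have "\<dots> \<le> real (n + 2) * \<kappa>" using pos by (intro mult_right_mono) auto
  finally have large: "4 * B\<^sup>2 * (R ^ 4 * h1) \<le> real (n + 2) * \<kappa>" .
  \<comment> \<open>\<open>?Q\<close> times \<delta>^2 is the upper bound of the integral estimate,
    \<open>?L\<close> the lower bound supplied by the ball around \<open>x0\<close>. Neither depends
    on the mollification.\<close>
  let ?Q = "real (n + 2) * (R ^ 4 * h1) ^ (n + 1) * B3\<^sup>2 * measure lborel (cball x0 R)"
  let ?L = "\<kappa> / 4 * (\<alpha> ^ (n + 2) * measure lborel (ball x0 \<rho>0))"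
  have "measure lborel (ball x0 \<rho>0) > 0" using content_ball_pos[OF \<rho>0(1), of x0] by simp
  then have L: "?L > 0" using pos \<alpha> by simp
  have Q0: "?Q \<ge> 0" using R h1 by simp
  have BB: "B + B2 \<ge> 0" and \<kappa>2: "\<kappa> / 2 > 0" using B0 pos by simp_all
  obtain \<delta> where \<delta>: "0 < \<delta>" "\<delta> \<le> 1" "(B + B2) * \<delta> \<le> \<kappa> / 2" "?Q * \<delta>\<^sup>2 < ?L"
    by (rule small_parameter[OF BB Q0 \<kappa>2 L]) (rule that; assumption)
  \<comment> \<open>The cutoff is at most R^4, so an error \<open>e1\<close> in \<open>h\<close>
    changes \<open>G\<close> by at most k/2 and at most \<alpha>.\<close>
  define e1 where "e1 = min 1 (min (k / 2) \<alpha> / R ^ 4)"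
  have e1: "e1 > 0" "e1 \<le> 1" "R ^ 4 * e1 \<le> k / 2" "R ^ 4 * e1 \<le> \<alpha>"
  proof -
    have "R ^ 4 * e1 \<le> R ^ 4 * (min (k / 2) \<alpha> / R ^ 4)" using R by (intro mult_left_mono) (auto simp: e1_def)
    then show "R ^ 4 * e1 \<le> k / 2" "R ^ 4 * e1 \<le> \<alpha>" using R by auto
  qed (use k \<alpha> R in \<open>auto simp: e1_def\<close>)
  have JK: "compact (J ` K)" "J ` K \<subseteq> O1"
    using compact_continuous_image[OF continuous_on_subset[OF J_cont K\<Omega>] cK] image_mono[OF K\<Omega>, of J] JO1
    by blast+
  obtain d1 where d1: "d1 > 0" "\<And>w w'. w \<in> J ` K \<Longrightarrow> dist w w' < d1 \<Longrightarrow> w' \<in> O1 \<and> dist (h w) (h w') < e1"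
    by (rule uniform_continuity_near_compact[OF O1 JK h_cont e1(1)]) (rule that; assumption)
  have "M0 \<subseteq> \<Omega>" using M0K K\<Omega> by (rule order_trans)
  then have JM: "compact (J ` M0)" "J ` M0 \<subseteq> O2"
    using compact_continuous_image[OF continuous_on_subset[OF J_cont] M0] image_mono[OF M0\<Omega>', of J] JO2
    by blast+
  have \<delta>2: "\<delta> / 2 > 0" using \<delta> by simp
  obtain d2 where d2: "d2 > 0" "\<And>w w'. w \<in> J ` M0 \<Longrightarrow> dist w w' < d2 \<Longrightarrow> w' \<in> O2 \<and> dist (\<Phi> w) (\<Phi> w') < \<delta> / 2"
    by (rule uniform_continuity_near_compact[OF O2 JM \<Phi>_cont \<delta>2]) (rule that; assumption)
  \<comment> \<open>The defect contains the Laplacian of \<open>U\<close> divided by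
    \<open>U\<close>, whereas the mollified equation compares the Laplacian with the source;
    division is therefore treated as a continuous map of its own.\<close>
  define O3 :: "(real \<times> real) set" where "O3 = {w. snd w > 0}"
  define dv :: "real \<times> real \<Rightarrow> real" where "dv w = fst w / snd w" for w
  have O3: "open O3" unfolding O3_def by (intro open_Collect_less continuous_intros)
  have dv_cont: "continuous_on O3 dv" unfolding dv_def O3_def by (intro continuous_intros) auto
  have su: "compact ((\<lambda>x. (s x, u x)) ` M0)" "(\<lambda>x. (s x, u x)) ` M0 \<subseteq> O3"
  proof -
    show "compact ((\<lambda>x. (s x, u x)) ` M0)"
      by (intro compact_continuous_image M0 continuous_intros continuous_on_subset[OF s_cont M0\<Omega>'] continuous_on_subset[OF u(2)])
        (use M0K K\<Omega> in auto)
    show "(\<lambda>x. (s x, u x)) ` M0 \<subseteq> O3" using upos M0K K\<Omega> by (auto simp: O3_def)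
  qed
  obtain d3 where d3: "d3 > 0" "\<And>w w'. w \<in> (\<lambda>x. (s x, u x)) ` M0 \<Longrightarrow> dist w w' < d3 \<Longrightarrow> w' \<in> O3 \<and> dist (dv w) (dv w') < \<delta> / 2"
    by (rule uniform_continuity_near_compact[OF O3 su dv_cont \<delta>2]) (rule that; assumption)
  \<comment> \<open>A pair moves by at most d + d if each entry moves by at most d.\<close>
  define d where "d = min d1 (min d2 d3) / 3"
  have d: "d > 0" "d + d < d1" "d + d < d2" "d + d < d3" using d1 d2 d3 by (auto simp: d_def)
  obtain \<epsilon>1 where \<epsilon>1: "\<epsilon>1 > 0" "\<And>x y. x \<in> K \<Longrightarrow> dist x y < \<epsilon>1 \<Longrightarrow> y \<in> \<Omega> \<and> dist (u x) (u y) < d"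
    by (rule uniform_continuity_near_compact[OF \<Omega>(1) cK K\<Omega> u(2) d(1)]) (rule that; assumption)
  obtain \<epsilon>2 where \<epsilon>2: "\<epsilon>2 > 0" "\<And>x y. x \<in> K \<Longrightarrow> dist x y < \<epsilon>2 \<Longrightarrow> y \<in> \<Omega> \<and> dist (grad u x) (grad u y) < d"
    by (rule uniform_continuity_near_compact[OF \<Omega>(1) cK K\<Omega> u(3) d(1)]) (rule that; assumption)
  obtain \<epsilon>3 where \<epsilon>3: "\<epsilon>3 > 0" "\<And>x y. x \<in> M0 \<Longrightarrow> dist x y < \<epsilon>3 \<Longrightarrow> y \<in> \<Omega>' \<and> dist (s x) (s y) < d"
    by (rule uniform_continuity_near_compact[OF \<Omega>' M0 M0\<Omega>' s_cont d(1)]) (rule that; assumption)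
  define \<epsilon> where "\<epsilon> = min R (min \<epsilon>1 (min \<epsilon>2 \<epsilon>3))"
  have \<epsilon>: "\<epsilon> > 0" "\<epsilon> \<le> R" "\<epsilon> \<le> \<epsilon>1" "\<epsilon> \<le> \<epsilon>2" "\<epsilon> \<le> \<epsilon>3" using \<epsilon>1 \<epsilon>2 \<epsilon>3 R by (auto simp: \<epsilon>_def)
  define lo where "lo = x0 - (\<chi> i. 2 * R)"
  define hi where "hi = x0 + (\<chi> i. 2 * R)"
  \<comment> \<open>The Euclidean norm is at most the sum of the N coordinates in absolute value,
    each bounded by 2 R.\<close>
  have Q\<Omega>: "cbox lo hi \<subseteq> \<Omega>"
  proof (rule order_trans[OF _ \<Omega>(2)], rule subsetI)
    fix y assume "y \<in> cbox lo hi"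
    then have "\<bar>(y - x0) $ i\<bar> \<le> 2 * R" for i
      by (auto simp: mem_box_cart lo_def hi_def abs_le_iff algebra_simps dest: spec[of _ i])
    then have "(\<Sum>i\<in>UNIV. \<bar>(y - x0) $ i\<bar>) \<le> (\<Sum>i\<in>(UNIV :: 'n set). 2 * R)" by (intro sum_mono)
    then have "norm (y - x0) \<le> 2 * ?N * R" using norm_le_l1_cart[of "y - x0"] by simp
    then show "y \<in> cball x0 (2 * ?N * R)" by (simp add: dist_norm norm_minus_commute)
  qed
  \<comment> \<open>A point within \<epsilon> \<le> R of \<open>K\<close> is within 2 R of
    \<open>x0\<close>, hence in the cube.\<close>
  have KQ: "cball x \<epsilon> \<subseteq> cbox lo hi" if "x \<in> K" for x
  proof
    fix y assume "y \<in> cball x \<epsilon>"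
    then have "dist x0 y \<le> 2 * R" using that \<epsilon>(2) dist_triangle[of x0 y x] by (simp add: K_def)
    then have "\<bar>(y - x0) $ i\<bar> \<le> 2 * R" for i
      using component_le_norm_cart[of "y - x0" i] by (simp add: dist_norm norm_minus_commute)
    then show "y \<in> cbox lo hi" by (auto simp: mem_box_cart lo_def hi_def abs_le_iff algebra_simps)
  qed

  \<comment> \<open>Passage to the mollified solution\<close>
  obtain U DU D2U D3U where
    U1: "\<And>x. GDERIV U x :> DU x" and U2: "\<And>x i. GDERIV (\<lambda>x. DU x $ i) x :> D2U x $ i"
    and U3: "\<And>x i j. GDERIV (\<lambda>x. D2U x $ i $ j) x :> D3U x $ i $ j"
    and U4: "continuous_on UNIV D3U" and U5: "\<And>x i j. D2U x $ i $ j = D2U x $ j $ i"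
    and U6: "\<And>x i j k. D3U x $ i $ j $ k = D3U x $ i $ k $ j"
    and Uu: "\<And>x \<delta>. cball x \<epsilon> \<subseteq> cbox lo hi \<Longrightarrow> (\<And>y. dist x y < \<epsilon> \<Longrightarrow> dist (u x) (u y) \<le> \<delta>) \<Longrightarrow>
      dist (u x) (U x) \<le> \<delta>"
    and UDu: "\<And>x \<delta>. cball x \<epsilon> \<subseteq> cbox lo hi \<Longrightarrow> (\<And>y. dist x y < \<epsilon> \<Longrightarrow> dist (grad u x) (grad u y) \<le> \<delta>) \<Longrightarrow>
      dist (grad u x) (DU x) \<le> \<delta>"
    and Us: "\<And>x \<delta> c. cball x \<epsilon> \<subseteq> cbox lo hi \<Longrightarrow>
      (\<And>y. dist x y < \<epsilon> \<Longrightarrow> dist c (enn2real (source p q u y)) \<le> \<delta>) \<Longrightarrow>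
      dist c (- (\<Sum>i\<in>UNIV. D2U x $ i $ i)) \<le> \<delta>"
    by (fact mollified_solution_exists[OF \<Omega>(1) Q\<Omega> \<epsilon>(1) sol])
  have near_u: "dist (u x) (U x) \<le> d" if "x \<in> K" for x
  proof (rule Uu[OF KQ[OF that]])
    fix y assume "dist x y < \<epsilon>"
    then have "dist x y < \<epsilon>1" using \<epsilon> by linarith
    then show "dist (u x) (u y) \<le> d" using \<epsilon>1(2)[OF that] by (simp add: s_def less_imp_le)
  qed
  have near_grad: "dist (grad u x) (DU x) \<le> d" if "x \<in> K" for x
  proof (rule UDu[OF KQ[OF that]])
    fix y assume "dist x y < \<epsilon>"
    then have "dist x y < \<epsilon>2" using \<epsilon> by linarith
    then show "dist (grad u x) (grad u y) \<le> d" using \<epsilon>2(2)[OF that] by (simp add: s_def less_imp_le)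
  qed
  have near_s: "dist (s x) (- (\<Sum>i\<in>UNIV. D2U x $ i $ i)) \<le> d" if "x \<in> M0" for x
  proof (rule Us[OF KQ[OF subsetD[OF M0K that]]])
    fix y assume "dist x y < \<epsilon>"
    then have "dist x y < \<epsilon>3" using \<epsilon> by linarith
    then show "dist (s x) (enn2real (source p q u y)) \<le> d" using \<epsilon>3(2)[OF that] by (simp add: s_def less_imp_le)
  qed
  have near_J: "dist (J x) (U x, DU x) \<le> d + d" if "x \<in> K" for x
    unfolding J_def using dist_Pair_le[of "u x" "grad u x" "U x" "DU x"] near_u[OF that] near_grad[OF that] by linarith
  have Upos: "U x > 0" and near_h: "\<bar>h (U x, DU x) - h (J x)\<bar> < e1" if "x \<in> K" for x
    using d1(2)[of "J x" "(U x, DU x)"] near_J[OF that] d that by (auto simp: O1_def dist_real_def)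
  define S where "S = {x \<in> ball x0 R. U x > 0 \<and> DU x \<noteq> 0}"
  have SK: "S \<subseteq> K" by (auto simp: S_def K_def)
  have cU: "continuous_on A U" for A by (rule GDERIV_imp_continuous_on[OF U1])
  have cDU: "continuous_on A DU" for A by (rule continuous_on_components, rule GDERIV_imp_continuous_on[OF U2])
  have S: "open S" unfolding S_def
    by (intro open_Collect_conj open_Collect_less open_Collect_neq cU cDU continuous_intros) (simp add: open_ball[unfolded ball_def])
  let ?V = "\<lambda>x. inverse (U x) *\<^sub>R DU x"
  let ?W = "\<lambda>x. \<chi> i. inverse (U x) *\<^sub>R D2U x $ i - (inverse (U x) * DU x $ i) *\<^sub>R (inverse (U x) *\<^sub>R DU x)"
  have SU: "\<And>x. x \<in> S \<Longrightarrow> U x > 0" "\<And>x. x \<in> S \<Longrightarrow> DU x \<noteq> 0" by (simp_all add: S_def)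
  obtain T where "log_gradient U ?V ?W T S"
    using log_gradient_logarithm[OF U1 U2 U3 U4 U5 U6 S SU] by blast
  then interpret L: log_gradient U ?V ?W T S x0 R a q .
  have LH: "L.H x = h (U x, DU x)" for x
    by (simp add: L.H_def h_def power2_eq_square divide_inverse)
  have LF: "L.F x = \<Phi> (U x, DU x)" for x by (simp add: L.F_def \<Phi>_def LH)
  have LG: "L.G x = (\<eta> x)\<^sup>2 * h (U x, DU x)" for x
    by (simp add: L.G_def L.E_def L.\<eta>_def \<eta>_def LH)
  have near_G: "\<bar>L.G x - G0 x\<bar> \<le> R ^ 4 * e1" if "x \<in> K" for x
  proof -
    have "\<bar>L.G x - G0 x\<bar> = (\<eta> x)\<^sup>2 * \<bar>h (U x, DU x) - h (J x)\<bar>"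
      by (simp add: LG G0_def right_diff_distrib[symmetric] abs_mult)
    also have "\<dots> \<le> R ^ 4 * e1" using \<eta>4[OF that] near_h[OF that] by (intro mult_mono) auto
    finally show ?thesis .
  qed
  define M where "M = {x \<in> K. L.G x \<ge> k}"
  have MK: "M \<subseteq> K" by (auto simp: M_def)
  have MM0: "M \<subseteq> M0"
  proof
    fix x assume "x \<in> M"
    then have "x \<in> K" "L.G x \<ge> k" by (auto simp: M_def)
    then show "x \<in> M0" using near_G[of x] e1(3) by (auto simp: M0_def abs_le_iff)
  qed
  have M: "compact M"
  proof -
    have "continuous_on K (\<lambda>x. (\<eta> x)\<^sup>2 * h (U x, DU x))"
      unfolding \<eta>_def
      by (intro continuous_intros continuous_on_compose2[OF h_cont] cU cDU) (use Upos in \<open>auto simp: O1_def\<close>)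
    then have "closed (K \<inter> L.G -` {k..})"
      unfolding LG[abs_def] by (rule continuous_closed_preimage) (use cK in \<open>auto intro: compact_imp_closed\<close>)
    then have "compact (K \<inter> (K \<inter> L.G -` {k..}))" using cK by (rule compact_Int_closed[rotated])
    moreover have "K \<inter> (K \<inter> L.G -` {k..}) = M" by (auto simp: M_def)
    ultimately show ?thesis by simp
  qed
  \<comment> \<open>Positivity of \<open>G\<close> excludes the zeros of \<open>DU\<close> and,
    through the cutoff, the sphere of radius \<open>R\<close>.\<close>
  have MS: "M \<subseteq> S"
  proof
    fix x assume x: "x \<in> M"
    then have G: "L.G x > 0" using k by (simp add: M_def)
    have "DU x \<noteq> 0" using G by (auto simp: LG h_def)
    moreover have "dist x0 x \<noteq> R" using G by (auto simp: LG \<eta>_def dist_norm dot_square_norm norm_minus_commute)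
    ultimately show "x \<in> S" using x MK Upos by (auto simp: S_def K_def)
  qed
  have r_small: "\<bar>L.r x\<bar> \<le> \<delta>" and F_le: "L.F x \<le> f1" if x: "x \<in> M" for x
  proof -
    have xM0: "x \<in> M0" and xK: "x \<in> K" and x\<Omega>': "x \<in> \<Omega>'" using x MM0 M0K M0\<Omega>' by auto
    let ?l = "\<Sum>i\<in>UNIV. D2U x $ i $ i"
    \<comment> \<open>The defect is minus the Laplacian of \<open>U\<close> over \<open>U\<close>,
      minus \<Phi>(U, DU). Both quantities lie within \<delta>/2 of \<Phi>(J x), the first because
      s/u = \<Phi>(J x) on \<open>\<Omega>'\<close>.\<close>
    have 1: "\<bar>\<Phi> (J x) - \<Phi> (U x, DU x)\<bar> < \<delta> / 2"
      using d2(2)[of "J x" "(U x, DU x)"] near_J[OF xK] d xM0 by (auto simp: dist_real_def)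
    then show "L.F x \<le> f1" using f1(2)[OF xM0] \<delta> unfolding LF by linarith
    have "dist (s x, u x) (- ?l, U x) \<le> d + d"
      using dist_Pair_le[of "s x" "u x" "- ?l" "U x"] near_s[OF xM0] near_u[OF xK] by linarith
    then have "\<bar>dv (s x, u x) - dv (- ?l, U x)\<bar> < \<delta> / 2"
      using d3(2)[of "(s x, u x)" "(- ?l, U x)"] d xM0 by (auto simp: dist_real_def)
    moreover have "dv (s x, u x) = \<Phi> (J x)"
      using s[OF x\<Omega>'] upos x\<Omega>' by (force simp: dv_def \<Omega>'_def)
    moreover have "L.tr x = ?l / U x - L.H x"
      unfolding L.tr_def L.H_def
      by (simp add: sum_subtractf inner_vec_def divide_inverse sum_distrib_left mult_ac)
    then have "L.r x = dv (- ?l, U x) - \<Phi> (U x, DU x)" unfolding L.r_def LF dv_def fst_conv snd_conv minus_divide_left[symmetric] by linarith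
    ultimately show "\<bar>L.r x\<bar> \<le> \<delta>" using 1 by linarith
  qed

  \<comment> \<open>Contradiction between the two integral bounds\<close>
  have "\<kappa> / 4 * (LINT x:M|lborel. max 0 (L.G x - k) ^ (n + 2))
      \<le> real (n + 2) * (R ^ 4 * h1) ^ (n + 1) * (B3\<^sup>2 * \<delta>\<^sup>2) * measure lborel (cball x0 R)"
  proof (rule L.superlevel_integral_estimate[OF N form cC R k ck M MS _ _ _ _ F_le r_small _ \<delta>(2) _
        \<eta>0_def h0_def \<kappa>_def s1_def m_def B_def B2_def B3_def \<delta>(3) large])
    show "L.G x \<le> k" if "x \<in> S" "x \<notin> M" for x using that SK by (auto simp: M_def)
    show "k \<le> L.G x" if "x \<in> M" for x using that by (simp add: M_def)
    show "x \<in> ball x0 R" if "x \<in> M" for x using that MS by (auto simp: S_def)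
    show "L.H x \<le> h1" if "x \<in> M" for x
      using near_h[of x] h1(2)[of x] e1(2) that MK unfolding LH by fastforce
  qed (use h1 f1 in auto)
  also have "\<dots> = ?Q * \<delta>\<^sup>2" by (simp add: mult_ac)
  also have "\<dots> < ?L" by (rule \<delta>(4))
  \<comment> \<open>The chain returns to the integral with which it started; the strict step was the
    choice of \<delta>.\<close>
  also have "\<dots> \<le> \<kappa> / 4 * (LINT x:M|lborel. max 0 (L.G x - k) ^ (n + 2))"
  proof (rule mult_left_mono)
    have ball_M: "L.G x - k \<ge> \<alpha>" "x \<in> M" if "x \<in> ball x0 \<rho>0" for x
    proof -
      have xK: "x \<in> K" using that \<rho>0 by auto
      then show "L.G x - k \<ge> \<alpha>" using G0_ball[OF that] near_G[OF xK] e1(4) by linarith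
      then show "x \<in> M" using xK \<alpha> by (simp add: M_def)
    qed
    have GM: "continuous_on M (\<lambda>x. max 0 (L.G x - k) ^ (n + 2))"
      using continuous_on_subset[OF L.continuous_on_jets(10) MS] by (intro continuous_intros)
    have "\<alpha> ^ (n + 2) * measure lborel (ball x0 \<rho>0) = (LINT x|lborel. indicator (ball x0 \<rho>0) x *\<^sub>R \<alpha> ^ (n + 2))"
      using emeasure_lborel_ball_finite[of x0 \<rho>0] by (simp add: mult.commute)
    also have "\<dots> \<le> (LINT x:M|lborel. max 0 (L.G x - k) ^ (n + 2))"
      unfolding set_lebesgue_integral_def
    proof (rule integral_mono)
      show "integrable lborel (\<lambda>x. indicat_real (ball x0 \<rho>0) x *\<^sub>R \<alpha> ^ (n + 2))"
        using emeasure_lborel_ball_finite[of x0 \<rho>0] by (simp add: integrable_real_indicator)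
      show "integrable lborel (\<lambda>x. indicat_real M x *\<^sub>R max 0 (L.G x - k) ^ (n + 2))"
        by (rule borel_integrable_compact[OF M GM])
      show "indicat_real (ball x0 \<rho>0) x *\<^sub>R \<alpha> ^ (n + 2) \<le> indicat_real M x *\<^sub>R max 0 (L.G x - k) ^ (n + 2)" for x
      proof (cases "x \<in> ball x0 \<rho>0")
        case True
        have "\<alpha> ^ (n + 2) \<le> max 0 (L.G x - k) ^ (n + 2)"
          using ball_M(1)[OF True] \<alpha> by (intro power_mono) auto
        then show ?thesis using ball_M(2)[OF True] True by simp
      next
        case False
        then show ?thesis by simp
      qed
    qed
    finally show "\<alpha> ^ (n + 2) * measure lborel (ball x0 \<rho>0) \<le> (LINT x:M|lborel. max 0 (L.G x - k) ^ (n + 2))" .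
  qed (use pos in simp)
  finally show False by simp
qed

text \<open>The ball is connected and meets \<open>\<Omega>\<close>, so it could leave
  \<open>\<Omega>\<close> only across the frontier, which is farther away than
  \<open>r\<close>.\<close>

lemma cball_subset_of_lt_infdist_frontier:
  fixes x :: "'a::real_normed_vector"
  assumes "open \<Omega>" "x \<in> \<Omega>" "\<Omega> \<noteq> UNIV" "r < infdist x (frontier \<Omega>)"
  shows "cball x r \<subseteq> \<Omega>"
proof (rule ccontr)
  assume "\<not> cball x r \<subseteq> \<Omega>"
  then obtain y where y: "y \<in> cball x r" "y \<notin> \<Omega>" by blast
  have "0 \<le> r" using y zero_le_dist[of x y] unfolding mem_cball by linarith
  then have "x \<in> cball x r \<inter> \<Omega>" using assms by simp
  moreover have "y \<in> cball x r - \<Omega>" using y by simp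
  ultimately have "cball x r \<inter> frontier \<Omega> \<noteq> {}"
    using connected_Int_frontier[of "cball x r" \<Omega>] convex_connected[OF convex_cball] by blast
  then obtain z where "z \<in> frontier \<Omega>" "dist x z \<le> r" by auto
  then show False using infdist_le[of z "frontier \<Omega>" x] assms by simp
qed

theorem theorem1p1:
  fixes p q :: real
  assumes "CARD('n::finite) \<ge> 2"
    and "p + q < (real CARD('n) + 3) / (real CARD('n) - 1)"
  shows "\<exists>C>0. \<forall>(\<Omega> :: (real^'n) set) u.
    open \<Omega> \<and> connected \<Omega> \<and> \<Omega> \<noteq> {} \<and> positive_weak_solution p q \<Omega> u \<longrightarrow>
    (\<forall>x\<in>\<Omega>. norm (grad u x) / u x \<le> C * inv_dist_boundary \<Omega> x)"
proof -
  let ?N = "real CARD('n)"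
  have nu: "?N - 1 > 0" using assms(1) by simp
  \<comment> \<open>Since (N + 3)/(N - 1) - 1 = 4/(N - 1).\<close>
  have "p + q - 1 < 4 / (?N - 1)" using assms(2) nu by (simp add: field_simps)
  then obtain c C where cC: "c > 0" "C \<ge> 0" and form: "\<And>F H s. F \<ge> 0 \<Longrightarrow> H \<ge> 0 \<Longrightarrow>
      c * H\<^sup>2 - C * s\<^sup>2 \<le> (F + H + s)\<^sup>2 / (?N - 1) - (p + q - 1) * F * H - (q * F + 2 * H) * s"
    using subcritical_quadratic_form[OF nu] by metis
  \<comment> \<open>The square root of the bound at the centre; the factor 2 N returns from R = r/(2
    N) to the radius r.\<close>
  define A where "A = 2 * ?N * sqrt ((4 * C + 13 + 2 * ?N) / c)"
  have A: "A > 0" using cC assms(1) by (simp add: A_def add_nonneg_pos)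
  have ball: "norm (grad u x) / u x \<le> A / r"
    if "open \<Omega>" "positive_weak_solution p q \<Omega> u" "r > 0" "cball x r \<subseteq> \<Omega>"
    for \<Omega> :: "(real^'n) set" and u x r
  proof -
    define R where "R = r / (2 * ?N)"
    have R: "R > 0" "2 * ?N * R = r" using that assms(1) by (simp_all add: R_def)
    have x: "x \<in> \<Omega>" using that by auto
    then have u: "u x > 0" using that by (simp add: positive_weak_solution_def)
    have "R\<^sup>2 * ((grad u x \<bullet> grad u x) / (u x)\<^sup>2) \<le> (4 * C + 13 + 2 * ?N) / c"
      by (rule logarithmic_gradient_at_center[OF assms(1) form cC that(1) _ R(1) that(2)]) (use R that in auto)
    then have "(R * (norm (grad u x) / u x))\<^sup>2 \<le> (4 * C + 13 + 2 * ?N) / c"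
      by (simp add: dot_square_norm power_mult_distrib power_divide)
    then have "R * (norm (grad u x) / u x) \<le> sqrt ((4 * C + 13 + 2 * ?N) / c)"
      by (rule real_le_rsqrt)
    then have "2 * ?N * (R * (norm (grad u x) / u x)) \<le> A"
      unfolding A_def by (rule mult_left_mono) simp
    then have "r * (norm (grad u x) / u x) \<le> A" using R(2) by (metis mult.assoc)
    then show ?thesis using that by (simp add: le_divide_eq mult.commute)
  qed
  show ?thesis
  proof (intro exI[of _ A] conjI A allI impI ballI)
    fix \<Omega> :: "(real^'n) set" and u x
    assume \<Omega>: "open \<Omega> \<and> connected \<Omega> \<and> \<Omega> \<noteq> {} \<and> positive_weak_solution p q \<Omega> u" and x: "x \<in> \<Omega>"
    have u: "u x > 0" using \<Omega> x by (simp add: positive_weak_solution_def)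
    define X where "X = norm (grad u x) / u x"
    have X0: "X \<ge> 0" using u by (simp add: X_def)
    show "norm (grad u x) / u x \<le> A * inv_dist_boundary \<Omega> x"
    proof (cases "\<Omega> = UNIV")
      case True
      have "X \<le> 0"
      proof (rule ccontr)
        assume "\<not> X \<le> 0"
        \<comment> \<open>Balls of every radius are available, and the radius 2 A/X would give X
          \<le> X/2.\<close>
        then have "X > 0" by simp
        then show False using ball[of \<Omega> u "2 * A / X" x] \<Omega> True A by (simp add: X_def[symmetric] field_simps)
      qed
      then show ?thesis using True by (simp add: inv_dist_boundary_def X_def)
    next
      case False
      define D where "D = infdist x (frontier \<Omega>)"
      have fr: "frontier \<Omega> \<noteq> {}" using \<Omega> False frontier_not_empty by blast
      have "x \<notin> frontier \<Omega>" using \<Omega> x by (simp add: frontier_def interior_open)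
      then have D: "D > 0" using infdist_pos_not_in_closed[OF frontier_closed fr] by (simp add: D_def)
      have rX: "r * X \<le> A" if "0 < r" "r < D" for r
      proof -
        have "cball x r \<subseteq> \<Omega>"
          using \<Omega> x False that by (intro cball_subset_of_lt_infdist_frontier) (auto simp: D_def)
        then have "X \<le> A / r" unfolding X_def using \<Omega> that by (intro ball) auto
        then show ?thesis using that by (simp add: le_divide_eq mult.commute)
      qed
      have "D * X \<le> A"
      proof (rule ccontr)
        assume "\<not> D * X \<le> A"
        then have DX: "A < D * X" by simp
        then have X: "X > 0" using X0 A by (cases "X = 0") auto
        \<comment> \<open>The closed ball of radius \<open>D\<close> may reach the frontier, so a
          radius strictly between A/X and \<open>D\<close> is taken.\<close>
        define r where "r = (A / X + D) / 2"
        have "A / X < D" using DX X by (simp add: divide_less_eq)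
        moreover have "0 < A / X" using A X by simp
        moreover have "0 < (b + D) / 2 \<and> (b + D) / 2 < D \<and> b < (b + D) / 2" if "b < D" "0 < b" for b
          using that by simp
        ultimately have "0 < r" "r < D" "A / X < r" unfolding r_def by blast+
        then show False using rX[of r] X by (simp add: divide_less_eq)
      qed
      then have "X \<le> A / D" using D by (simp add: le_divide_eq mult.commute)
      then show ?thesis using False by (simp add: inv_dist_boundary_def X_def D_def)
    qed
  qed
qed

end
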